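(* There exists an absolute constant $c>0$ such that the following holds. Let $k\ge 2$ be an integer, let $\lambda,\mu_k,D,\epsilon>0$ and $d\in\mathbb{N}$ satisfy $$D>\sqrt{\frac{\mu_k}{k!\,2^{\frac{k+3}{2}}\lambda}+\sqrt{2}\left(\frac{\mu_k}{k!\,2^{\frac{k+3}{2}}\lambda}\right)^{3/2}},\qquad \epsilon<\frac{\lambda}{32},\qquad d\le\left(\frac{\mu_k D^{k-1}}{k!\,2^{\frac{k+3}{2}}\lambda}\right)^{\frac{2}{3k+1}}.$$ Then for every deterministic algorithm on $\mathbb{R}^d$ based on a $k$-th order oracle there exists a function $f:\mathbb{R}^d\to\mathbb{R}$ such that: (i) $f$ is $\lambda$-strongly convex, $k$ times differentiable with $\mu_k$-Lipschitz $k$-th order derivative, and has a global minimum $x^*$ satisfying $\|x^1-x^*\|\le D$; (ii) where $x^1,x^2,\dots$ are the points produced by the algorithm when run on $f$, any index $T$ with $f(x^T)-f(x^* )\le\epsilon$ satisfies $T\ge c\cdot d$.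
   Context: A $k$-th order oracle for $f:\mathbb{R}^d\to\mathbb{R}$, given a point $x\in\mathbb{R}^d$, returns $f(x),\nabla f(x),\nabla^2 f(x),\dots,\nabla^k f(x)$. A (deterministic) algorithm based on a $k$-th order oracle produces a sequence $x^1,x^2,\dots\in\mathbb{R}^d$, where each $x^t$ is a fixed deterministic function of the oracle's responses at $x^1,\dots,x^{t-1}$ (in particular $x^1$ is fixed by the algorithm, independently of $f$). $\|\cdot\|$ is the Euclidean norm on vectors. The $k$-th derivative is $\mu_k$-Lipschitz if $\|\nabla^k f(x)-\nabla^k f(y)\|\le\mu_k\|x-y\|$ for all $x,y$, where the norm of a $k$-tensor is the operator norm $\|A\|=\max_{\|z\|=1}\left|\sum_{i_1,\dots,i_k}A_{i_1,\dots,i_k}z_{i_1}\cdots z_{i_k}\right|$. A twice differentiable $f$ is $\lambda$-strongly convex if $\nabla^2 f(x)\succeq\lambda I$ for all $x$. *)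

theory Defs
  imports "HOL-Analysis.Analysis"
begin

text \<open>
  The absolute constant is chosen before the dimension \<open>d\<close>, so \<open>d\<close> has to be a term rather than
  a type.  A point of \<open>\<real>\<^sup>d\<close> is therefore a sequence that vanishes from index \<open>d\<close> on, as in
  \<^const>\<open>Euclidean_space\<close>.  A function on \<open>\<real>\<^sup>d\<close> is a total function on sequences of which
  only the values on that carrier matter: every notion below evaluates it on the carrier only.
\<close>

abbreviation Rd :: "nat \<Rightarrow> (nat \<Rightarrow> real) set" where
  "Rd d \<equiv> topspace (Euclidean_space d)"

definition enorm :: "nat \<Rightarrow> (nat \<Rightarrow> real) \<Rightarrow> real" where
  "enorm d x = L2_set x {..<d}"

definition edist :: "nat \<Rightarrow> (nat \<Rightarrow> real) \<Rightarrow> (nat \<Rightarrow> real) \<Rightarrow> real" where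
  "edist d x y = enorm d (\<lambda>i. x i - y i)"

subsection \<open>Derivatives\<close>

definition frechet_differentiable_at ::
    "nat \<Rightarrow> ((nat \<Rightarrow> real) \<Rightarrow> real) \<Rightarrow> (nat \<Rightarrow> real) \<Rightarrow> bool" where
  "frechet_differentiable_at d f x \<longleftrightarrow>
     (\<exists>g. \<forall>e>0. \<exists>\<delta>>0. \<forall>y\<in>Rd d. edist d y x < \<delta> \<longrightarrow>
        \<bar>f y - f x - (\<Sum>i<d. g i * (y i - x i))\<bar> \<le> e * edist d y x)"

text \<open>Changing coordinate \<open>i < d\<close> of a point of \<open>\<real>\<^sup>d\<close> stays inside \<open>\<real>\<^sup>d\<close>.\<close>

definition partial_deriv ::
    "nat \<Rightarrow> ((nat \<Rightarrow> real) \<Rightarrow> real) \<Rightarrow> (nat \<Rightarrow> real) \<Rightarrow> real" where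
  "partial_deriv i f x = deriv (\<lambda>s. f (x(i := s))) (x i)"

fun iterated_partial ::
    "nat list \<Rightarrow> ((nat \<Rightarrow> real) \<Rightarrow> real) \<Rightarrow> (nat \<Rightarrow> real) \<Rightarrow> real" where
  "iterated_partial [] f = f"
| "iterated_partial (i # is) f = partial_deriv i (iterated_partial is f)"

text \<open>
  A function is \<open>n + 1\<close> times differentiable iff it is differentiable everywhere and its derivative,
  that is, each of the \<open>d\<close> components of its gradient, is \<open>n\<close> times differentiable.
\<close>

fun times_differentiable :: "nat \<Rightarrow> nat \<Rightarrow> ((nat \<Rightarrow> real) \<Rightarrow> real) \<Rightarrow> bool" where
  "times_differentiable d 0 f = True"
| "times_differentiable d (Suc n) f \<longleftrightarrow>
     (\<forall>x\<in>Rd d. frechet_differentiable_at d f x) \<and>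
     (\<forall>i<d. times_differentiable d n (partial_deriv i f))"

subsection \<open>Tensors\<close>

text \<open>
  A \<open>k\<close>-tensor on \<open>\<real>\<^sup>d\<close> assigns a number to each index list of length \<open>k\<close> with entries below
  \<open>d\<close>.  Derivative tensors are set to \<open>0\<close> on all other lists, so that a response
  carries no information beyond the entries of the tensors.
\<close>

type_synonym tensor = "nat list \<Rightarrow> real"

definition tensor_indices :: "nat \<Rightarrow> nat \<Rightarrow> nat list set" where
  "tensor_indices d k = {is. length is = k \<and> set is \<subseteq> {..<d}}"

definition tensor_form :: "nat \<Rightarrow> nat \<Rightarrow> tensor \<Rightarrow> (nat \<Rightarrow> real) \<Rightarrow> real" where
  "tensor_form d k A z = (\<Sum>is\<in>tensor_indices d k. A is * (\<Prod>i\<leftarrow>is. z i))"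

text \<open>
  The supremum is a maximum, by compactness of the unit sphere.  For \<open>d = 0\<close> the unit sphere is
  empty and the value is unspecified.
\<close>

definition tensor_norm :: "nat \<Rightarrow> nat \<Rightarrow> tensor \<Rightarrow> real" where
  "tensor_norm d k A = (SUP z\<in>{z\<in>Rd d. enorm d z = 1}. \<bar>tensor_form d k A z\<bar>)"

definition nabla :: "nat \<Rightarrow> nat \<Rightarrow> ((nat \<Rightarrow> real) \<Rightarrow> real) \<Rightarrow> (nat \<Rightarrow> real) \<Rightarrow> tensor" where
  "nabla d k f x = (\<lambda>is. if is \<in> tensor_indices d k then iterated_partial is f x else 0)"

subsection \<open>The function class\<close>

definition strongly_convex :: "nat \<Rightarrow> real \<Rightarrow> ((nat \<Rightarrow> real) \<Rightarrow> real) \<Rightarrow> bool" where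
  "strongly_convex d lam f \<longleftrightarrow>
     times_differentiable d 2 f \<and>
     (\<forall>x\<in>Rd d. \<forall>v\<in>Rd d.
        0 \<le> (\<Sum>i<d. \<Sum>j<d. v i * (nabla d 2 f x [i, j] - lam * (if i = j then 1 else 0)) * v j))"

definition lipschitz_kth_derivative ::
    "nat \<Rightarrow> nat \<Rightarrow> real \<Rightarrow> ((nat \<Rightarrow> real) \<Rightarrow> real) \<Rightarrow> bool" where
  "lipschitz_kth_derivative d k \<mu> f \<longleftrightarrow>
     (\<forall>x\<in>Rd d. \<forall>y\<in>Rd d.
        tensor_norm d k (\<lambda>is. nabla d k f x is - nabla d k f y is) \<le> \<mu> * edist d x y)"

definition global_minimum :: "nat \<Rightarrow> ((nat \<Rightarrow> real) \<Rightarrow> real) \<Rightarrow> (nat \<Rightarrow> real) \<Rightarrow> bool" where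
  "global_minimum d f x \<longleftrightarrow> x \<in> Rd d \<and> (\<forall>y\<in>Rd d. f x \<le> f y)"

subsection \<open>Oracles and deterministic algorithms\<close>

text \<open>The response at \<open>x\<close> lists the derivative tensors of orders \<open>0, \<dots>, k\<close>.\<close>

type_synonym response = "tensor list"

definition query_response :: "nat \<Rightarrow> nat \<Rightarrow> ((nat \<Rightarrow> real) \<Rightarrow> real) \<Rightarrow> (nat \<Rightarrow> real) \<Rightarrow> response" where
  "query_response d k f x = map (\<lambda>j. nabla d j f x) [0..<Suc k]"

text \<open>
  An algorithm maps the list of all previous responses, oldest first, to the next point.  The list
  determines the number of the round, so the rule may vary from round to round.
\<close>

type_synonym algorithm = "response list \<Rightarrow> nat \<Rightarrow> real"

definition deterministic_algorithm :: "nat \<Rightarrow> algorithm \<Rightarrow> bool" where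
  "deterministic_algorithm d alg \<longleftrightarrow> (\<forall>rs. alg rs \<in> Rd d)"

primrec responses ::
    "nat \<Rightarrow> nat \<Rightarrow> algorithm \<Rightarrow> ((nat \<Rightarrow> real) \<Rightarrow> real) \<Rightarrow> nat \<Rightarrow> response list" where
  "responses d k alg f 0 = []"
| "responses d k alg f (Suc n) =
     responses d k alg f n @ [query_response d k f (alg (responses d k alg f n))]"

text \<open>Points are numbered from \<open>1\<close>: the \<open>t\<close>-th point depends on \<open>t - 1\<close> responses.\<close>

definition iterate ::
    "nat \<Rightarrow> nat \<Rightarrow> algorithm \<Rightarrow> ((nat \<Rightarrow> real) \<Rightarrow> real) \<Rightarrow> nat \<Rightarrow> (nat \<Rightarrow> real)" where
  "iterate d k alg f t = alg (responses d k alg f (t - 1))"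

end

theory Submission
  imports Defs
begin

text \<open>
  With \<open>B = \<mu> / (k! 2\<^bsup>(k+3)/2\<^esup>)\<close>, \<open>n = d div 2\<close>, \<open>y = x - x\<^sup>1\<close> and orthonormal
  \<open>v\<^sub>0, \<dots>, v\<^sub>n\<^sub>-\<^sub>1\<close>, the hard function is
  \<open>\<lambda>/2 |y|\<^sup>2 - \<gamma> \<langle>v\<^sub>0, y\<rangle> + B/(k+1) \<Sum>\<^sub>j max(0, \<langle>v\<^sub>j - v\<^sub>j\<^sub>+\<^sub>1, y\<rangle>)\<^bsup>k+1\<^esup>\<close>.
  All derivatives up to order \<open>k\<close> of the last summands vanish where their argument vanishes, so an
  adversary can choose \<open>v\<^sub>t\<close> after query \<open>t\<close> (counted from \<open>0\<close>), orthogonal to all queries so far and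
  to the earlier vectors; since \<open>2n \<le> d\<close> there is always room.  Solving the optimality conditions
  backwards from the last coordinate, \<open>\<gamma>\<close> can be tuned so that the minimiser has decreasing
  coordinates \<open>w\<^sub>0 \<ge> \<dots> \<ge> w\<^sub>n\<^sub>-\<^sub>1 = 1/4\<close>.  Each of the first \<open>n\<close> queries misses one of them
  completely, and by strong convexity is at least \<open>\<lambda>/2 (1/4)\<^sup>2 = \<lambda>/32\<close> away from the optimum.  The
  hypotheses on \<open>d\<close> and \<open>D\<close> give \<open>n w\<^sub>0\<^sup>2 \<le> D\<^sup>2\<close>.
\<close>


section \<open>Inner product and norm on R^d\<close>

definition ip :: "nat \<Rightarrow> (nat \<Rightarrow> real) \<Rightarrow> (nat \<Rightarrow> real) \<Rightarrow> real" where
  "ip d x y = (\<Sum>i<d. x i * y i)"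

lemma ip_commute: "ip d x y = ip d y x"
  by (simp add: ip_def mult.commute)

lemma ip_diff_left: "ip d (\<lambda>i. x i - y i) z = ip d x z - ip d y z"
  by (simp add: ip_def algebra_simps sum_subtractf)

lemma ip_diff_right: "ip d z (\<lambda>i. x i - y i) = ip d z x - ip d z y"
  by (simp add: ip_def algebra_simps sum_subtractf)

lemma ip_sum_right: "ip d z (\<lambda>i. \<Sum>j\<in>J. c j * u j i) = (\<Sum>j\<in>J. c j * ip d z (u j))"
  unfolding ip_def sum_distrib_left by (subst sum.swap) (simp add: algebra_simps)

lemma ip_self_nonneg: "0 \<le> ip d x x"
  by (simp add: ip_def sum_nonneg)

lemma enorm_eq_sqrt_ip: "enorm d x = sqrt (ip d x x)"
  by (simp add: enorm_def L2_set_def ip_def power2_eq_square)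

lemma enorm_nonneg: "0 \<le> enorm d x"
  by (simp add: enorm_eq_sqrt_ip ip_self_nonneg)

lemma edist_nonneg: "0 \<le> edist d x y"
  by (simp add: edist_def enorm_nonneg)

lemma abs_ip_le: "\<bar>ip d x y\<bar> \<le> enorm d x * enorm d y"
proof -
  have "\<bar>ip d x y\<bar> \<le> (\<Sum>i<d. \<bar>x i\<bar> * \<bar>y i\<bar>)"
    unfolding ip_def by (rule order_trans[OF sum_abs]) (simp add: abs_mult)
  also have "\<dots> \<le> enorm d x * enorm d y"
    unfolding enorm_def by (rule L2_set_mult_ineq)
  finally show ?thesis .
qed

lemma mem_Rd_iff: "x \<in> Rd d \<longleftrightarrow> (\<forall>i\<ge>d. x i = 0)"
  by (simp add: topspace_Euclidean_space)

section \<open>Gradients and the chain rule\<close>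

text \<open>Exposes the witness hidden in \<open>frechet_differentiable_at\<close>, so that the
  gradients of summands can be added.\<close>

definition has_gradient_at ::
    "nat \<Rightarrow> ((nat \<Rightarrow> real) \<Rightarrow> real) \<Rightarrow> (nat \<Rightarrow> real) \<Rightarrow> (nat \<Rightarrow> real) \<Rightarrow> bool" where
  "has_gradient_at d f x g \<longleftrightarrow>
     (\<forall>e>0. \<exists>\<delta>>0. \<forall>y\<in>Rd d. edist d y x < \<delta> \<longrightarrow>
        \<bar>f y - f x - ip d g (\<lambda>i. y i - x i)\<bar> \<le> e * edist d y x)"

lemma frechet_differentiable_iff_gradient:
  "frechet_differentiable_at d f x \<longleftrightarrow> (\<exists>g. has_gradient_at d f x g)"
  by (simp add: frechet_differentiable_at_def has_gradient_at_def ip_def)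

lemma has_gradient_at_add:
  assumes "has_gradient_at d f x g" "has_gradient_at d f' x g'"
  shows "has_gradient_at d (\<lambda>y. f y + f' y) x (\<lambda>i. g i + g' i)"
  unfolding has_gradient_at_def
proof (intro allI impI)
  fix e :: real assume "e > 0"
  then have "e/2 > 0" by simp
  with assms(1) obtain \<delta> where d: "\<delta> > 0"
    "\<And>y. y\<in>Rd d \<Longrightarrow> edist d y x < \<delta> \<Longrightarrow> \<bar>f y - f x - ip d g (\<lambda>i. y i - x i)\<bar> \<le> e/2 * edist d y x"
    unfolding has_gradient_at_def by blast
  from assms(2) \<open>e/2 > 0\<close> obtain \<delta>' where d': "\<delta>' > 0"
    "\<And>y. y\<in>Rd d \<Longrightarrow> edist d y x < \<delta>' \<Longrightarrow> \<bar>f' y - f' x - ip d g' (\<lambda>i. y i - x i)\<bar> \<le> e/2 * edist d y x"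
    unfolding has_gradient_at_def by blast
  have "\<bar>f y + f' y - (f x + f' x) - ip d (\<lambda>i. g i + g' i) (\<lambda>i. y i - x i)\<bar> \<le> e * edist d y x"
    if "y \<in> Rd d" "edist d y x < min \<delta> \<delta>'" for y
  proof -
    have "ip d (\<lambda>i. g i + g' i) (\<lambda>i. y i - x i) = ip d g (\<lambda>i. y i - x i) + ip d g' (\<lambda>i. y i - x i)"
      by (simp add: ip_def distrib_right sum.distrib)
    moreover have "\<bar>f y - f x - ip d g (\<lambda>i. y i - x i)\<bar> \<le> e/2 * edist d y x"
      "\<bar>f' y - f' x - ip d g' (\<lambda>i. y i - x i)\<bar> \<le> e/2 * edist d y x"
      using d(2)[of y] d'(2)[of y] that by auto
    moreover have "e * edist d y x = e/2 * edist d y x + e/2 * edist d y x" by simp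
    ultimately show ?thesis by linarith
  qed
  then show "\<exists>\<delta>>0. \<forall>y\<in>Rd d. edist d y x < \<delta> \<longrightarrow>
      \<bar>f y + f' y - (f x + f' x) - ip d (\<lambda>i. g i + g' i) (\<lambda>i. y i - x i)\<bar> \<le> e * edist d y x"
    using d(1) d'(1) by (intro exI[of _ "min \<delta> \<delta>'"]) auto
qed

lemma has_gradient_at_const: "has_gradient_at d (\<lambda>_. c) x (\<lambda>_. 0)"
  unfolding has_gradient_at_def
  by (intro allI impI exI[of _ 1]) (simp add: ip_def edist_nonneg)

lemma has_gradient_at_sum:
  assumes "finite J" "\<And>j. j \<in> J \<Longrightarrow> has_gradient_at d (f j) x (g j)"
  shows "has_gradient_at d (\<lambda>y. \<Sum>j\<in>J. f j y) x (\<lambda>i. \<Sum>j\<in>J. g j i)"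
  using assms
proof (induction J)
  case empty then show ?case by (simp add: has_gradient_at_const)
next
  case (insert j J) then show ?case by (simp add: has_gradient_at_add)
qed

lemma has_gradient_at_ridge:
  assumes "(h has_real_derivative h') (at (ip d a (\<lambda>i. x i - p i)))"
  shows "has_gradient_at d (\<lambda>y. h (ip d a (\<lambda>i. y i - p i))) x (\<lambda>i. h' * a i)"
  unfolding has_gradient_at_def
proof (intro allI impI)
  fix e :: real assume e: "e > 0"
  define t0 where "t0 = ip d a (\<lambda>i. x i - p i)"
  \<comment> \<open>The added 1 keeps \<open>C\<close> positive when \<open>a\<close> vanishes, so
    that dividing by it is safe.\<close>
  define C where "C = enorm d a + 1"
  have C: "C > 0" using enorm_nonneg[of d a] by (simp add: C_def)
  have "(h has_derivative (\<lambda>t. t * h')) (at t0)"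
    using assms unfolding t0_def has_field_derivative_def by (simp add: mult.commute[of _ h'])
  moreover have "e / C > 0" using e C by simp
  ultimately obtain \<delta> where dl: "\<delta> > 0"
    "\<And>t. \<bar>t - t0\<bar> < \<delta> \<Longrightarrow> \<bar>h t - h t0 - (t - t0) * h'\<bar> \<le> e / C * \<bar>t - t0\<bar>"
    unfolding has_derivative_at_alt real_norm_def by blast
  have "\<bar>h (ip d a (\<lambda>i. y i - p i)) - h (ip d a (\<lambda>i. x i - p i)) - ip d (\<lambda>i. h' * a i) (\<lambda>i. y i - x i)\<bar>
     \<le> e * edist d y x" if "edist d y x < \<delta> / C" for y
  proof -
    define t where "t = ip d a (\<lambda>i. y i - p i)"
    have tt: "t - t0 = ip d a (\<lambda>i. y i - x i)"
      by (simp add: t_def t0_def ip_diff_right)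
    have "\<bar>t - t0\<bar> \<le> enorm d a * edist d y x"
      unfolding tt edist_def by (rule abs_ip_le)
    also have "\<dots> \<le> C * edist d y x"
      by (rule mult_right_mono) (auto simp: C_def edist_nonneg)
    finally have le: "\<bar>t - t0\<bar> \<le> C * edist d y x" .
    also have "\<dots> < \<delta>" using that C by (simp add: field_simps)
    finally have "\<bar>h t - h t0 - (t - t0) * h'\<bar> \<le> e / C * \<bar>t - t0\<bar>" by (rule dl(2))
    also have "\<dots> \<le> e / C * (C * edist d y x)"
      using le e C by (intro mult_left_mono) auto
    also have "\<dots> = e * edist d y x" using C by simp
    finally have "\<bar>h t - h t0 - (t - t0) * h'\<bar> \<le> e * edist d y x" .
    moreover have "ip d (\<lambda>i. h' * a i) (\<lambda>i. y i - x i) = (t - t0) * h'"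
      unfolding tt by (simp add: ip_def sum_distrib_left sum_distrib_right mult_ac)
    ultimately show ?thesis by (simp add: t_def t0_def)
  qed
  then show "\<exists>\<delta>>0. \<forall>y\<in>Rd d. edist d y x < \<delta> \<longrightarrow>
     \<bar>h (ip d a (\<lambda>i. y i - p i)) - h (ip d a (\<lambda>i. x i - p i)) - ip d (\<lambda>i. h' * a i) (\<lambda>i. y i - x i)\<bar>
     \<le> e * edist d y x"
    using dl(1) C by (intro exI[of _ "\<delta> / C"]) auto
qed

section \<open>Sums of ridge functions and their derivatives\<close>

text \<open>\<open>G j m\<close> stands for the m-th derivative of the j-th profile, and the index
  list records the partial derivatives already taken. This makes the family closed under further
  ones: each contributes a component of \<open>a j\<close> and raises the order in
  \<open>G j\<close> by one.\<close>

definition ridge_sum ::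
    "nat \<Rightarrow> 'j set \<Rightarrow> ('j \<Rightarrow> nat \<Rightarrow> real) \<Rightarrow> (nat \<Rightarrow> real) \<Rightarrow> ('j \<Rightarrow> nat \<Rightarrow> real \<Rightarrow> real) \<Rightarrow>
      nat list \<Rightarrow> (nat \<Rightarrow> real) \<Rightarrow> real" where
  "ridge_sum d J a p G is x =
     (\<Sum>j\<in>J. (\<Prod>i\<leftarrow>is. a j i) * G j (length is) (ip d (a j) (\<lambda>i. x i - p i)))"

lemma partial_deriv_ridge_sum:
  assumes "i < d"
    and G: "\<And>j u. j \<in> J \<Longrightarrow> (G j (length is) has_real_derivative G j (Suc (length is)) u) (at u)"
  shows "partial_deriv i (ridge_sum d J a p G is) = ridge_sum d J a p G (i # is)"
proof
  fix x
  have aff: "ip d (a j) (\<lambda>l. (x(i := s)) l - p l) = ip d (a j) (\<lambda>l. x l - p l) + a j i * (s - x i)" for s j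
  proof -
    have "ip d (a j) (\<lambda>l. (x(i := s)) l - p l) - ip d (a j) (\<lambda>l. x l - p l)
        = (\<Sum>l<d. if l = i then a j i * (s - x i) else 0)"
      unfolding ip_def sum_subtractf[symmetric]
      by (rule sum.cong) (auto simp: algebra_simps)
    then show ?thesis using assms(1) by simp
  qed
  have "((\<lambda>s. (\<Prod>l\<leftarrow>is. a j l) * G j (length is) (ip d (a j) (\<lambda>l. x l - p l) + a j i * (s - x i)))
     has_real_derivative (\<Prod>l\<leftarrow>i # is. a j l) * G j (length (i # is)) (ip d (a j) (\<lambda>l. x l - p l))) (at (x i))"
    if "j \<in> J" for j
  proof -
    have "((\<lambda>s. G j (length is) (ip d (a j) (\<lambda>l. x l - p l) + a j i * (s - x i)))
      has_real_derivative G j (Suc (length is)) (ip d (a j) (\<lambda>l. x l - p l)) * (a j i)) (at (x i))"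
      by (rule DERIV_chain2[of "G j (length is)"]) (auto intro!: derivative_eq_intros G that)
    from DERIV_cmult[OF this, of "\<Prod>l\<leftarrow>is. a j l"] show ?thesis by (simp add: algebra_simps)
  qed
  then have "((\<lambda>s. ridge_sum d J a p G is (x(i := s))) has_real_derivative
      ridge_sum d J a p G (i # is) x) (at (x i))"
    unfolding ridge_sum_def aff by (rule DERIV_sum)
  then show "partial_deriv i (ridge_sum d J a p G is) x = ridge_sum d J a p G (i # is) x"
    unfolding partial_deriv_def by (rule DERIV_imp_deriv)
qed

lemma frechet_differentiable_ridge_sum:
  assumes "finite J"
    and G: "\<And>j u. j \<in> J \<Longrightarrow> (G j (length is) has_real_derivative G j (Suc (length is)) u) (at u)"
  shows "frechet_differentiable_at d (ridge_sum d J a p G is) x"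
proof -
  have "has_gradient_at d (ridge_sum d J a p G is) x
     (\<lambda>i. \<Sum>j\<in>J. (\<Prod>l\<leftarrow>is. a j l) * G j (Suc (length is)) (ip d (a j) (\<lambda>i. x i - p i)) * a j i)"
    unfolding ridge_sum_def
    by (intro has_gradient_at_sum assms(1) has_gradient_at_ridge[where h = "\<lambda>u. _ * G _ _ u"] DERIV_cmult G)
  then show ?thesis by (auto simp: frechet_differentiable_iff_gradient)
qed

lemma iterated_partial_ridge_sum:
  assumes "\<And>j m u. j \<in> J \<Longrightarrow> m < k \<Longrightarrow> (G j m has_real_derivative G j (Suc m) u) (at u)"
    and "length is \<le> k" "set is \<subseteq> {..<d}"
  shows "iterated_partial is (ridge_sum d J a p G []) = ridge_sum d J a p G is"
  using assms(2,3)
proof (induction "is")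
  case (Cons i "is")
  then show ?case using assms(1) by (simp add: partial_deriv_ridge_sum)
qed simp

lemma times_differentiable_ridge_sum:
  assumes "finite J"
    and G: "\<And>j m u. j \<in> J \<Longrightarrow> m < k \<Longrightarrow> (G j m has_real_derivative G j (Suc m) u) (at u)"
    and "length is + n \<le> k"
  shows "times_differentiable d n (ridge_sum d J a p G is)"
  using assms(3)
proof (induction n arbitrary: "is")
  case (Suc n)
  have "times_differentiable d n (partial_deriv i (ridge_sum d J a p G is))" if "i < d" for i
    using Suc.IH[of "i # is"] Suc.prems G that by (simp add: partial_deriv_ridge_sum)
  moreover have "frechet_differentiable_at d (ridge_sum d J a p G is) x" for x
    using Suc.prems by (intro frechet_differentiable_ridge_sum assms(1) G) auto
  ultimately show ?case by simp
qed simp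

section \<open>Derivative tensors of ridge sums\<close>

lemma tensor_indices_Suc:
  "tensor_indices d (Suc k) = (\<lambda>(i, is). i # is) ` ({..<d} \<times> tensor_indices d k)"
proof (intro set_eqI iffI)
  fix "is" assume "is \<in> tensor_indices d (Suc k)"
  then show "is \<in> (\<lambda>(i, is). i # is) ` ({..<d} \<times> tensor_indices d k)"
    by (cases "is") (auto simp: tensor_indices_def)
qed (auto simp: tensor_indices_def)

text \<open>Multiplying out the power yields one monomial per word of length \<open>k\<close>. This
  evaluates the form of a rank-one tensor.\<close>

lemma sum_tensor_indices_prod: "(\<Sum>is\<in>tensor_indices d k. \<Prod>i\<leftarrow>is. b i) = (\<Sum>i<d. b i :: real) ^ k"
proof (induction k)
  case 0
  have "tensor_indices d 0 = {[]}" by (auto simp: tensor_indices_def)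
  then show ?case by simp
next
  case (Suc k)
  have "(\<Sum>is\<in>tensor_indices d (Suc k). \<Prod>i\<leftarrow>is. b i)
      = (\<Sum>(i, is)\<in>{..<d} \<times> tensor_indices d k. b i * (\<Prod>i\<leftarrow>is. b i))"
    unfolding tensor_indices_Suc
    by (subst sum.reindex) (auto simp: inj_on_def intro!: sum.cong)
  also have "\<dots> = (\<Sum>i<d. b i) * (\<Sum>is\<in>tensor_indices d k. \<Prod>i\<leftarrow>is. b i)"
    by (simp add: sum_product sum.cartesian_product)
  finally show ?case by (simp add: Suc)
qed

lemma prod_list_mult: "(\<Prod>i\<leftarrow>is. a i * b i) = (\<Prod>i\<leftarrow>is. a i) * (\<Prod>i\<leftarrow>is. b i :: real)"
  by (induction "is") auto

lemma nabla_ridge_sum: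
  assumes G: "\<And>j m u. j \<in> J \<Longrightarrow> m < k \<Longrightarrow> (G j m has_real_derivative G j (Suc m) u) (at u)"
    and "l \<le> k"
  shows "nabla d l (ridge_sum d J a p G []) x is
     = (if is \<in> tensor_indices d l then ridge_sum d J a p G is x else 0)"
proof -
  have "iterated_partial is (ridge_sum d J a p G []) x = ridge_sum d J a p G is x"
    if "is \<in> tensor_indices d l"
    using that assms(2) by (subst iterated_partial_ridge_sum[of J k G]) (auto simp: tensor_indices_def G)
  then show ?thesis by (simp add: nabla_def)
qed

text \<open>Each ridge contributes a multiple of the \<open>k\<close>-fold tensor power of
  \<open>a j\<close>, whose form is a power of an inner product. Bounding the tensor norm thus
  becomes a question about scalars.\<close>

lemma tensor_form_nabla_diff_ridge_sum:
  assumes G: "\<And>j m u. j \<in> J \<Longrightarrow> m < k \<Longrightarrow> (G j m has_real_derivative G j (Suc m) u) (at u)"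
  shows "tensor_form d k (\<lambda>is. nabla d k (ridge_sum d J a p G []) x is
        - nabla d k (ridge_sum d J a p G []) y is) z
    = (\<Sum>j\<in>J. (G j k (ip d (a j) (\<lambda>i. x i - p i)) - G j k (ip d (a j) (\<lambda>i. y i - p i))) * ip d (a j) z ^ k)"
proof -
  let ?D = "\<lambda>j. G j k (ip d (a j) (\<lambda>i. x i - p i)) - G j k (ip d (a j) (\<lambda>i. y i - p i))"
  have "tensor_form d k (\<lambda>is. nabla d k (ridge_sum d J a p G []) x is
        - nabla d k (ridge_sum d J a p G []) y is) z
    = (\<Sum>is\<in>tensor_indices d k. (\<Sum>j\<in>J. (\<Prod>i\<leftarrow>is. a j i) * ?D j) * (\<Prod>i\<leftarrow>is. z i))"
    unfolding tensor_form_def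
    by (rule sum.cong)
       (auto simp: nabla_ridge_sum[of J k G k, OF G order_refl] ridge_sum_def right_diff_distrib sum_subtractf tensor_indices_def)
  also have "\<dots> = (\<Sum>j\<in>J. ?D j * (\<Sum>is\<in>tensor_indices d k. (\<Prod>i\<leftarrow>is. a j i * z i)))"
    unfolding sum_distrib_right sum_distrib_left
    by (subst sum.swap) (simp add: prod_list_mult algebra_simps)
  finally show ?thesis by (simp add: sum_tensor_indices_prod ip_def)
qed

section \<open>Unit vectors orthogonal to few given vectors\<close>

text \<open>Gaussian elimination, by induction on the equations: equation \<open>j0\<close> is
  dropped if all its coefficients vanish, and is otherwise used to eliminate one unknown
  \<open>i0\<close>, which back substitution recovers.\<close>

lemma underdetermined_system_nontrivial_solution:
  fixes a :: "'j \<Rightarrow> 'i \<Rightarrow> 'a :: field"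
  assumes "finite J" "finite I" "card J < card I"
  shows "\<exists>z. (\<exists>i\<in>I. z i \<noteq> 0) \<and> (\<forall>j\<in>J. (\<Sum>i\<in>I. a j i * z i) = 0)"
  using assms
proof (induction J arbitrary: I a)
  case empty
  then have "I \<noteq> {}" by auto
  then show ?case by (auto intro!: exI[of _ "\<lambda>_. 1"])
next
  case (insert j0 J)
  show ?case
  proof (cases "\<forall>i\<in>I. a j0 i = 0")
    case True
    have "card J < card I" using insert by simp
    with insert obtain z where "\<exists>i\<in>I. z i \<noteq> 0" "\<forall>j\<in>J. (\<Sum>i\<in>I. a j i * z i) = 0" by blast
    with True show ?thesis by (intro exI[of _ z]) auto
  next
    case False
    then obtain i0 where i0: "i0 \<in> I" "a j0 i0 \<noteq> 0" by auto
    define I' where "I' = I - {i0}"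
    have I: "I = insert i0 I'" "i0 \<notin> I'" "finite I'" using i0 insert by (auto simp: I'_def)
    have "card J < card I'" using insert I by simp
    with insert.IH[of I' "\<lambda>j i. a j i - a j i0 * (a j0 i / a j0 i0)"] I obtain z where
      z: "\<exists>i\<in>I'. z i \<noteq> 0" "\<forall>j\<in>J. (\<Sum>i\<in>I'. (a j i - a j i0 * (a j0 i / a j0 i0)) * z i) = 0" by auto
    define s where "s = (\<Sum>i\<in>I'. a j0 i * z i)"
    define z' where "z' = z(i0 := - s / a j0 i0)"
    have eq: "(\<Sum>i\<in>I. a j i * z' i) = a j i0 * (- s / a j0 i0) + (\<Sum>i\<in>I'. a j i * z i)" for j
    proof -
      have "(\<Sum>i\<in>I'. a j i * z' i) = (\<Sum>i\<in>I'. a j i * z i)"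
        using I by (intro sum.cong) (auto simp: z'_def)
      then show ?thesis using I by (simp add: z'_def)
    qed
    have "(\<Sum>i\<in>I. a j i * z' i) = 0" if "j \<in> insert j0 J" for j
    proof (cases "j = j0")
      case True then show ?thesis using i0 by (simp add: eq s_def)
    next
      case False
      then have "(\<Sum>i\<in>I'. (a j i - a j i0 * (a j0 i / a j0 i0)) * z i) = 0" using z(2) that by auto
      also have "(\<Sum>i\<in>I'. (a j i - a j i0 * (a j0 i / a j0 i0)) * z i)
         = (\<Sum>i\<in>I'. a j i * z i) - a j i0 / a j0 i0 * s"
        by (simp add: s_def sum_distrib_left sum_subtractf[symmetric] algebra_simps)
      finally show ?thesis by (simp add: eq)
    qed
    moreover have "\<exists>i\<in>I. z' i \<noteq> 0" using z(1) I by (auto simp: z'_def)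
    ultimately show ?thesis by blast
  qed
qed

lemma exists_unit_vector_orthogonal:
  assumes "finite J" "card J < d"
  shows "\<exists>u\<in>Rd d. ip d u u = 1 \<and> (\<forall>j\<in>J. ip d u (a j) = 0)"
proof -
  obtain z where z: "\<exists>i\<in>{..<d}. z i \<noteq> 0" "\<forall>j\<in>J. (\<Sum>i<d. a j i * z i) = 0"
    using underdetermined_system_nontrivial_solution[of J "{..<d}" a] assms by auto
  define N where "N = ip d z z"
  have N: "N > 0"
  proof -
    from z(1) obtain i where "i < d" "z i \<noteq> 0" by auto
    then show ?thesis unfolding N_def ip_def by (intro sum_pos2[of _ i]) (auto simp: less_le)
  qed
  define u where "u = (\<lambda>i. if i < d then z i / sqrt N else 0)"
  have "ip d u (a j) = ip d z (a j) / sqrt N" for j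
    by (simp add: u_def ip_def sum_divide_distrib)
  moreover have "ip d u u = ip d z z / N"
    using N by (simp add: u_def ip_def sum_divide_distrib)
  ultimately show ?thesis
    using z(2) N by (intro bexI[of _ u]) (auto simp: mem_Rd_iff u_def N_def ip_def mult.commute)
qed


section \<open>Truncated powers\<close>

text \<open>Only the kink at 0 needs an argument. There Caratheodory's criterion applies with slope
  function \<open>max 0 z ^ Suc e\<close>, which is continuous and vanishes at 0.\<close>

lemma DERIV_max0_power:
  "((\<lambda>u. max 0 u ^ Suc (Suc e)) has_real_derivative real (Suc (Suc e)) * max 0 u ^ Suc e) (at u)"
proof -
  consider "u > 0" | "u < 0" | "u = 0" by linarith
  then show ?thesis
  proof cases
    case 1
    have "((\<lambda>u. u ^ Suc (Suc e)) has_real_derivative real (Suc (Suc e)) * max 0 u ^ Suc e) (at u)"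
      using DERIV_pow[of "Suc (Suc e)" u] 1 by simp
    then show ?thesis
      by (rule has_field_derivative_transform_within_open[where S = "{0<..}"]) (use 1 in auto)
  next
    case 2
    have "((\<lambda>u. 0) has_real_derivative real (Suc (Suc e)) * max 0 u ^ Suc e) (at u)"
      using 2 by auto
    then show ?thesis
      by (rule has_field_derivative_transform_within_open[where S = "{..<0}"]) (use 2 in auto)
  next
    case 3
    have "isCont (\<lambda>z::real. max 0 z ^ Suc e) 0" by (intro continuous_intros)
    moreover have "max 0 z ^ Suc (Suc e) = max 0 z ^ Suc e * z" for z :: real
      by (simp add: max_def)
    ultimately show ?thesis
      unfolding CARAT_DERIV using 3 by (intro exI[of _ "\<lambda>z. max 0 z ^ Suc e"]) auto
  qed
qed

text \<open>Convexity of powers on the half-line. The gap for the next exponent is \<open>a\<close>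
  times the present gap plus a nonnegative multiple of the square of \<open>a - b\<close>.\<close>

lemma power_Suc_ge_tangent:
  fixes a b :: real
  assumes "a \<ge> 0" "b \<ge> 0"
  shows "a ^ Suc n - b ^ Suc n \<ge> real (Suc n) * b ^ n * (a - b)"
proof (induction n)
  case (Suc n)
  have "a ^ Suc (Suc n) - b ^ Suc (Suc n) - real (Suc (Suc n)) * b ^ Suc n * (a - b)
    = a * (a ^ Suc n - b ^ Suc n - real (Suc n) * b ^ n * (a - b)) + real (Suc n) * b ^ n * (a - b)\<^sup>2"
    by (simp add: algebra_simps power2_eq_square)
  moreover have "a * (a ^ Suc n - b ^ Suc n - real (Suc n) * b ^ n * (a - b)) \<ge> 0"
    using Suc assms by (intro mult_nonneg_nonneg) auto
  moreover have "real (Suc n) * b ^ n * (a - b)\<^sup>2 \<ge> 0"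
    using assms by (intro mult_nonneg_nonneg) auto
  ultimately show ?case by linarith
qed simp


text \<open>For \<open>t \<ge> 0\<close>, passing from \<open>u\<close> to \<open>max 0 u\<close>
  only raises the tangent value; for negative \<open>t\<close> the tangent is zero.\<close>

lemma max0_power_Suc_ge_tangent:
  fixes u t :: real
  assumes "n > 0"
  shows "max 0 u ^ Suc n - max 0 t ^ Suc n \<ge> real (Suc n) * max 0 t ^ n * (u - t)"
proof (cases "t \<ge> 0")
  case True
  then have "real (Suc n) * max 0 t ^ n * (u - t) \<le> real (Suc n) * max 0 t ^ n * (max 0 u - max 0 t)"
    by (intro mult_left_mono) auto
  then show ?thesis using power_Suc_ge_tangent[of "max 0 u" "max 0 t" n] by linarith
next
  case False
  with assms show ?thesis by (simp add: max_def zero_power)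
qed

section \<open>The hard function: smoothness and strong convexity\<close>

text \<open>
  \<open>profile k lam B g j m\<close> is the \<open>m\<close>-th derivative of the profile of the \<open>j\<close>-th ridge function.
\<close>

fun profile :: "nat \<Rightarrow> real \<Rightarrow> real \<Rightarrow> real \<Rightarrow> nat + nat \<Rightarrow> nat \<Rightarrow> real \<Rightarrow> real" where
  "profile k lam B g (Inl _) m u =
     lam * (if m = 0 then u\<^sup>2 / 2 else if m = 1 then u else if m = 2 then 1 else 0)"
| "profile k lam B g (Inr 0) m u = - g * (if m = 0 then u else if m = 1 then 1 else 0)"
| "profile k lam B g (Inr (Suc _)) m u = B * (fact k / fact (Suc k - m)) * max 0 u ^ (Suc k - m)"

text \<open>Makes all three terms of the hard function ridges: the unit vectors together give the
  quadratic term, \<open>Inr 0\<close> carries the linear term, and the remaining directions are the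
  links of the chain. For positive \<open>n\<close>, the \<open>Inr\<close> indices below
  \<open>n\<close> are thus the linear term and \<open>n - 1\<close> links.\<close>

fun dir :: "(nat \<Rightarrow> nat \<Rightarrow> real) \<Rightarrow> nat + nat \<Rightarrow> nat \<Rightarrow> real" where
  "dir v (Inl i) = (\<lambda>l. if l = i then 1 else 0)"
| "dir v (Inr 0) = v 0"
| "dir v (Inr (Suc j)) = (\<lambda>l. v j l - v (Suc j) l)"

definition hard_function ::
    "nat \<Rightarrow> nat \<Rightarrow> real \<Rightarrow> real \<Rightarrow> real \<Rightarrow> (nat \<Rightarrow> real) \<Rightarrow> (nat \<Rightarrow> nat \<Rightarrow> real) \<Rightarrow> nat \<Rightarrow>
      (nat \<Rightarrow> real) \<Rightarrow> real" where
  "hard_function d k lam B g p v n =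
     ridge_sum d ({..<d} <+> {..<n}) (dir v) p (profile k lam B g) []"

lemma DERIV_profile:
  assumes "m < k"
  shows "(profile k lam B g j m has_real_derivative profile k lam B g j (Suc m) u) (at u)"
proof -
  consider i where "j = Inl i" | "j = Inr 0" | q where "j = Inr (Suc q)"
    by (metis sum.exhaust nat.exhaust)
  then show ?thesis
  proof cases
    case 1
    have "profile k lam B g (Inl i) m = (\<lambda>u. lam * (if m = 0 then u\<^sup>2 / 2 else if m = 1 then u else if m = 2 then 1 else 0))"
      by (rule ext) simp
    then show ?thesis unfolding 1 by (auto intro!: derivative_eq_intros)
  next
    case 2
    have "profile k lam B g (Inr 0) m = (\<lambda>u. - g * (if m = 0 then u else if m = 1 then 1 else 0))"
      by (rule ext) simp
    then show ?thesis unfolding 2 by (auto intro!: derivative_eq_intros)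
  next
    case 3
    \<comment> \<open>As \<open>m < k\<close>, the exponent is at least 2, which is what
      differentiability at the kink requires.\<close>
    define e where "e = k - Suc m"
    have e: "Suc k - m = Suc (Suc e)" "Suc k - Suc m = Suc e" using assms by (auto simp: e_def)
    have eq: "B * (fact k / fact (Suc (Suc e))) * (real (Suc (Suc e)) * max 0 u ^ Suc e)
        = B * (fact k / fact (Suc e)) * max 0 u ^ Suc e"
      by (simp add: fact_Suc[of "Suc e"] del: fact_Suc)
    have "((\<lambda>u. B * (fact k / fact (Suc (Suc e))) * max 0 u ^ Suc (Suc e)) has_real_derivative
        B * (fact k / fact (Suc e)) * max 0 u ^ Suc e) (at u)"
      unfolding eq[symmetric] by (rule DERIV_cmult[OF DERIV_max0_power])
    moreover have "profile k lam B g (Inr (Suc q)) m = (\<lambda>u. B * (fact k / fact (Suc (Suc e))) * max 0 u ^ Suc (Suc e))"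
      by (rule ext) (simp only: profile.simps e)
    ultimately show ?thesis unfolding 3 by (simp only: profile.simps e)
  qed
qed

lemma times_differentiable_hard_function:
  assumes "n \<le> k"
  shows "times_differentiable d n (hard_function d k lam B g p v m)"
  unfolding hard_function_def
  by (rule times_differentiable_ridge_sum[of _ k]) (use assms in \<open>auto intro: DERIV_profile\<close>)

lemma nabla_hard_function:
  assumes "l \<le> k"
  shows "nabla d l (hard_function d k lam B g p v n) x is =
    (if is \<in> tensor_indices d l
     then ridge_sum d ({..<d} <+> {..<n}) (dir v) p (profile k lam B g) is x else 0)"
  unfolding hard_function_def by (rule nabla_ridge_sum[of _ k]) (auto intro: DERIV_profile assms)

text \<open>The unit directions contribute exactly \<open>lam\<close> times the identity to the
  Hessian. What remains is a sum of squares of linear forms with weights \<open>c q\<close>,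
  nonnegative because the other profiles are convex.\<close>

lemma strongly_convex_hard_function:
  assumes "k \<ge> 2" "B \<ge> 0"
  shows "strongly_convex d lam (hard_function d k lam B g p v n)"
  unfolding strongly_convex_def
proof (intro conjI ballI)
  show "times_differentiable d 2 (hard_function d k lam B g p v n)"
    using assms(1) by (rule times_differentiable_hard_function)
next
  fix x z :: "nat \<Rightarrow> real"
  define c where "c q = profile k lam B g (Inr q) 2 (ip d (dir v (Inr q)) (\<lambda>i. x i - p i))" for q
  have c: "c q \<ge> 0" for q
    using assms by (cases q) (auto simp: c_def)
  have N: "nabla d 2 (hard_function d k lam B g p v n) x [i, j] - lam * (if i = j then 1 else 0)
      = (\<Sum>q<n. c q * dir v (Inr q) i * dir v (Inr q) j)" if "i < d" "j < d" for i j
  proof -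
    have "(\<Sum>l<d. dir v (Inl l) i * dir v (Inl l) j * lam) = (\<Sum>l<d. if l = i then lam * (if i = j then 1 else 0) else 0)"
      by (rule sum.cong) auto
    also have "\<dots> = lam * (if i = j then 1 else 0)" using that by simp
    finally have "(\<Sum>l<d. dir v (Inl l) i * dir v (Inl l) j * lam) = lam * (if i = j then 1 else 0)" .
    then show ?thesis
      using that assms
      by (simp add: nabla_hard_function tensor_indices_def ridge_sum_def sum.Plus c_def numeral_2_eq_2 mult_ac
          del: dir.simps)
  qed
  have "(\<Sum>i<d. \<Sum>j<d. z i * (nabla d 2 (hard_function d k lam B g p v n) x [i, j] - lam * (if i = j then 1 else 0)) * z j)
     = (\<Sum>i<d. \<Sum>j<d. \<Sum>q<n. c q * ((dir v (Inr q) i * z i) * (dir v (Inr q) j * z j)))"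
    by (intro sum.cong refl) (simp add: N sum_distrib_left sum_distrib_right mult_ac)
  also have "\<dots> = (\<Sum>q<n. \<Sum>i<d. \<Sum>j<d. c q * ((dir v (Inr q) i * z i) * (dir v (Inr q) j * z j)))"
    by (subst sum.swap[of _ "{..<n}"]) (rule sum.swap)
  also have "\<dots> = (\<Sum>q<n. c q * (ip d (dir v (Inr q)) z)\<^sup>2)"
    unfolding ip_def power2_eq_square sum_product by (simp only: sum_distrib_left)
  also have "\<dots> \<ge> 0" by (intro sum_nonneg mult_nonneg_nonneg c) auto
  finally show "0 \<le> (\<Sum>i<d. \<Sum>j<d. z i * (nabla d 2 (hard_function d k lam B g p v n) x [i, j] - lam * (if i = j then 1 else 0)) * z j)" .
qed

section \<open>Orthonormal systems and the Lipschitz constant\<close>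

definition orthonormal :: "nat \<Rightarrow> nat \<Rightarrow> (nat \<Rightarrow> nat \<Rightarrow> real) \<Rightarrow> bool" where
  "orthonormal d n v \<longleftrightarrow> (\<forall>i<n. \<forall>j<n. ip d (v i) (v j) = (if i = j then 1 else 0))"

lemma ip_orthonormal_combination:
  assumes "orthonormal d n v" "i < n"
  shows "ip d (v i) (\<lambda>l. \<Sum>j<n. c j * v j l) = c i"
proof -
  have "ip d (v i) (\<lambda>l. \<Sum>j<n. c j * v j l) = (\<Sum>j<n. if j = i then c i else 0)"
    unfolding ip_sum_right using assms by (intro sum.cong) (auto simp: orthonormal_def)
  then show ?thesis using assms(2) by simp
qed

lemma ip_self_orthonormal_combination:
  assumes "orthonormal d n v"
  shows "ip d (\<lambda>l. \<Sum>j<n. c j * v j l) (\<lambda>l. \<Sum>j<n. c j * v j l) = (\<Sum>j<n. (c j)\<^sup>2)"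
proof -
  let ?y = "\<lambda>l. \<Sum>j<n. c j * v j l"
  have "ip d ?y ?y = (\<Sum>j<n. c j * ip d ?y (v j))" by (rule ip_sum_right)
  also have "\<dots> = (\<Sum>j<n. (c j)\<^sup>2)"
    by (intro sum.cong refl)
       (subst ip_commute, simp add: ip_orthonormal_combination[OF assms] power2_eq_square)
  finally show ?thesis .
qed

text \<open>The difference between \<open>x\<close> and its projection \<open>y\<close> has a
  nonnegative square norm.\<close>

lemma bessel_inequality:
  assumes "orthonormal d n v"
  shows "(\<Sum>j<n. (ip d (v j) x)\<^sup>2) \<le> ip d x x"
proof -
  define c where "c j = ip d (v j) x" for j
  define y where "y = (\<lambda>l. \<Sum>j<n. c j * v j l)"
  have "ip d x y = (\<Sum>j<n. c j * ip d x (v j))" unfolding y_def by (rule ip_sum_right)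
  then have "ip d x y = (\<Sum>j<n. (c j)\<^sup>2)"
    by (simp add: c_def ip_commute[of d x] power2_eq_square)
  moreover have "ip d y y = (\<Sum>j<n. (c j)\<^sup>2)"
    unfolding y_def by (rule ip_self_orthonormal_combination[OF assms])
  moreover have "0 \<le> ip d (\<lambda>i. x i - y i) (\<lambda>i. x i - y i)" by (rule ip_self_nonneg)
  ultimately show ?thesis by (simp add: ip_diff_left ip_diff_right ip_commute[of d y x] c_def)
qed

lemma two_square_diff_le: "(a - b)\<^sup>2 \<le> 2 * (a\<^sup>2 + b\<^sup>2)" for a b :: real
proof -
  have "0 \<le> (a + b)\<^sup>2" by simp
  then show ?thesis by (simp add: power2_eq_square algebra_simps)
qed

text \<open>Each \<open>v i\<close> occurs in at most two links, so Bessel's inequality enters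
  twice, each time with the factor 2 of \<open>two_square_diff_le\<close>.\<close>

lemma sum_chain_squares_le:
  assumes "orthonormal d (Suc n) v"
  shows "(\<Sum>j<n. (ip d (dir v (Inr (Suc j))) x)\<^sup>2) \<le> 4 * ip d x x"
proof -
  have "(\<Sum>j<n. (ip d (dir v (Inr (Suc j))) x)\<^sup>2)
      \<le> (\<Sum>j<n. 2 * ((ip d (v j) x)\<^sup>2 + (ip d (v (Suc j)) x)\<^sup>2))"
    by (intro sum_mono) (simp only: dir.simps ip_diff_left two_square_diff_le)
  also have "\<dots> = 2 * (\<Sum>j<n. (ip d (v j) x)\<^sup>2) + 2 * (\<Sum>j<n. (ip d (v (Suc j)) x)\<^sup>2)"
    by (simp add: sum.distrib sum_distrib_left)
  also have "(\<Sum>j<n. (ip d (v j) x)\<^sup>2) \<le> (\<Sum>j<Suc n. (ip d (v j) x)\<^sup>2)" by simp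
  also have "(\<Sum>j<n. (ip d (v (Suc j)) x)\<^sup>2) \<le> (\<Sum>j<Suc n. (ip d (v j) x)\<^sup>2)"
    unfolding sum.lessThan_Suc_shift by simp
  also have "(\<Sum>j<Suc n. (ip d (v j) x)\<^sup>2) \<le> ip d x x" by (rule bessel_inequality[OF assms])
  finally show ?thesis by simp
qed

lemma chain_square_le:
  assumes "orthonormal d n v" "Suc j < n"
  shows "(ip d (dir v (Inr (Suc j))) x)\<^sup>2 \<le> 2 * ip d x x"
proof -
  have "(ip d (v j) x)\<^sup>2 + (ip d (v (Suc j)) x)\<^sup>2 = (\<Sum>i\<in>{j, Suc j}. (ip d (v i) x)\<^sup>2)" by simp
  also have "\<dots> \<le> (\<Sum>i<n. (ip d (v i) x)\<^sup>2)" using assms(2) by (intro sum_mono2) auto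
  also have "\<dots> \<le> ip d x x" by (rule bessel_inequality[OF assms(1)])
  finally show ?thesis
    using two_square_diff_le[of "ip d (v j) x" "ip d (v (Suc j)) x"] by (simp add: ip_diff_left)
qed

text \<open>The origin of the constant 2^((k+3)/2). Cauchy-Schwarz separates \<open>x\<close> from
  \<open>z\<close>. The \<open>x\<close> sum of squares is at most 4 times the square norm. In the
  \<open>z\<close> sum, all but one of the \<open>k\<close> squared factors are bounded by 2 each
  and the last one is summed to at most 4, giving 2^(k+1).\<close>

lemma chain_tensor_bound:
  assumes "orthonormal d (Suc n) v" "k \<ge> 1" "ip d z z = 1"
  shows "(\<Sum>j<n. \<bar>ip d (dir v (Inr (Suc j))) x\<bar> * \<bar>ip d (dir v (Inr (Suc j))) z\<bar> ^ k)
    \<le> 2 powr ((real k + 3) / 2) * enorm d x"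
proof -
  define a where "a x j = \<bar>ip d (dir v (Inr (Suc j))) x\<bar>" for x j
  have "(\<Sum>j<n. (a z j ^ k)\<^sup>2) \<le> (\<Sum>j<n. 2 ^ (k - 1) * (a z j)\<^sup>2)"
  proof (intro sum_mono)
    fix j assume "j \<in> {..<n}"
    then have le: "(a z j)\<^sup>2 \<le> 2"
      using chain_square_le[OF assms(1), of j z] assms(3) by (simp add: a_def)
    have "(a z j ^ k)\<^sup>2 = ((a z j)\<^sup>2) ^ (k - 1) * (a z j)\<^sup>2"
      using assms(2) by (cases k) (simp_all add: power_mult_distrib flip: power_mult, simp add: mult.commute)
    also have "\<dots> \<le> 2 ^ (k - 1) * (a z j)\<^sup>2"
      using le by (intro mult_right_mono power_mono) auto
    finally show "(a z j ^ k)\<^sup>2 \<le> 2 ^ (k - 1) * (a z j)\<^sup>2" .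
  qed
  also have "\<dots> \<le> 2 ^ (k - 1) * (4 * ip d z z)"
    unfolding sum_distrib_left[symmetric] a_def power2_abs
    by (intro mult_left_mono sum_chain_squares_le[OF assms(1)]) auto
  also have "\<dots> = 2 ^ (k + 1)" using assms(2,3) by (cases k) auto
  finally have Z: "(\<Sum>j<n. (a z j ^ k)\<^sup>2) \<le> 2 ^ (k + 1)" .
  have X: "(\<Sum>j<n. (a x j)\<^sup>2) \<le> 4 * ip d x x"
    unfolding a_def power2_abs by (rule sum_chain_squares_le[OF assms(1)])
  have "(\<Sum>j<n. a x j * a z j ^ k) \<le> L2_set (a x) {..<n} * L2_set (\<lambda>j. a z j ^ k) {..<n}"
    using L2_set_mult_ineq[of "a x" "\<lambda>j. a z j ^ k" "{..<n}"] by (simp add: a_def)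
  also have "\<dots> \<le> sqrt (4 * ip d x x) * sqrt (2 ^ (k + 1))"
    unfolding L2_set_def by (intro mult_mono real_sqrt_le_mono X Z) (auto intro!: sum_nonneg ip_self_nonneg)
  also have "\<dots> = sqrt (2 ^ (k + 3)) * enorm d x"
  proof -
    have "2 ^ (k + 3) = (4 * 2 ^ (k + 1) :: real)" by (simp add: power_add)
    then show ?thesis by (simp only: enorm_eq_sqrt_ip real_sqrt_mult mult_ac)
  qed
  also have "sqrt (2 ^ (k + 3)) = 2 powr ((real k + 3) / 2)"
    by (simp add: powr_half_sqrt[symmetric] powr_realpow[symmetric] powr_powr add.commute)
  finally show ?thesis by (simp add: a_def)
qed

text \<open>For \<open>k \<ge> 2\<close> the quadratic and linear terms have constant
  \<open>k\<close>-th derivatives, which cancel in the difference. The \<open>k\<close>-th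
  derivative of a chain profile is \<open>B * fact k\<close> times the positive part, and the
  positive part is 1-Lipschitz.\<close>

lemma lipschitz_hard_function:
  assumes "orthonormal d n v" "k \<ge> 2" "d \<ge> 1" "B \<ge> 0"
  shows "lipschitz_kth_derivative d k (B * fact k * 2 powr ((real k + 3) / 2))
    (hard_function d k lam B g p v n)"
  unfolding lipschitz_kth_derivative_def
proof (intro ballI)
  fix x y assume "x \<in> Rd d" "y \<in> Rd d"
  let ?f = "hard_function d k lam B g p v n"
  let ?c = "2 powr ((real k + 3) / 2)"
  have "\<bar>tensor_form d k (\<lambda>is. nabla d k ?f x is - nabla d k ?f y is) z\<bar> \<le> B * fact k * ?c * edist d x y"
    if z: "enorm d z = 1" for z
  proof -
    define t where "t j = (profile k lam B g j k (ip d (dir v j) (\<lambda>i. x i - p i))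
        - profile k lam B g j k (ip d (dir v j) (\<lambda>i. y i - p i))) * ip d (dir v j) z ^ k" for j
    have "tensor_form d k (\<lambda>is. nabla d k ?f x is - nabla d k ?f y is) z
        = (\<Sum>j\<in>{..<d} <+> {..<n}. t j)"
      unfolding hard_function_def t_def
      by (rule tensor_form_nabla_diff_ridge_sum) (auto intro: DERIV_profile)
    also have "\<dots> = (\<Sum>q<n. t (Inr q))"
      using assms(2) by (simp add: sum.Plus t_def)
    finally have eq: "tensor_form d k (\<lambda>is. nabla d k ?f x is - nabla d k ?f y is) z = (\<Sum>q<n. t (Inr q))" .
    have "\<bar>\<Sum>q<n. t (Inr q)\<bar> \<le> B * fact k * ?c * edist d x y"
    proof (cases n)
      case 0
      then show ?thesis using assms(4) by (simp add: edist_nonneg)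
    next
      case (Suc n')
      let ?a = "\<lambda>j. dir v (Inr (Suc j))"
      have t: "\<bar>t (Inr (Suc q))\<bar> \<le> B * fact k * (\<bar>ip d (?a q) (\<lambda>i. x i - y i)\<bar> * \<bar>ip d (?a q) z\<bar> ^ k)" for q
      proof -
        define X Y where "X = ip d (?a q) (\<lambda>i. x i - p i)" and "Y = ip d (?a q) (\<lambda>i. y i - p i)"
        have XY: "X - Y = ip d (?a q) (\<lambda>i. x i - y i)" by (simp add: X_def Y_def ip_diff_right)
        have "t (Inr (Suc q)) = B * fact k * ((max 0 X - max 0 Y) * ip d (?a q) z ^ k)"
          by (simp add: t_def X_def Y_def algebra_simps)
        then have "\<bar>t (Inr (Suc q))\<bar> = B * fact k * (\<bar>max 0 X - max 0 Y\<bar> * \<bar>ip d (?a q) z\<bar> ^ k)"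
          using assms(4) by (simp add: abs_mult power_abs)
        also have "\<dots> \<le> B * fact k * (\<bar>X - Y\<bar> * \<bar>ip d (?a q) z\<bar> ^ k)"
          using assms(4) by (intro mult_left_mono mult_right_mono) auto
        finally show ?thesis by (simp only: XY)
      qed
      have "(\<Sum>q<n. t (Inr q)) = (\<Sum>q<n'. t (Inr (Suc q)))"
        using assms(2) unfolding Suc sum.lessThan_Suc_shift by (simp add: t_def)
      then have "\<bar>\<Sum>q<n. t (Inr q)\<bar> \<le> (\<Sum>q<n'. \<bar>t (Inr (Suc q))\<bar>)" by simp
      also have "\<dots> \<le> (\<Sum>q<n'. B * fact k * (\<bar>ip d (?a q) (\<lambda>i. x i - y i)\<bar> * \<bar>ip d (?a q) z\<bar> ^ k))"
        by (intro sum_mono t)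
      also have "\<dots> \<le> B * fact k * (?c * edist d x y)"
        unfolding sum_distrib_left[symmetric] edist_def
        using assms z Suc by (intro mult_left_mono chain_tensor_bound) (auto simp: enorm_eq_sqrt_ip)
      finally show ?thesis by (simp add: mult_ac)
    qed
    then show ?thesis by (simp add: eq)
  qed
  \<comment> \<open>The least-upper-bound rule needs an inhabited sphere; \<open>d \<ge> 1\<close>
    supplies a unit vector.\<close>
  moreover have "{z \<in> Rd d. enorm d z = 1} \<noteq> {}"
  proof -
    have "(\<lambda>i. if i = 0 then 1 else 0) \<in> {z \<in> Rd d. enorm d z = 1}"
      using assms(3) by (auto simp: mem_Rd_iff enorm_eq_sqrt_ip ip_def if_distrib if_distribR cong: if_cong)
    then show ?thesis by blast
  qed
  ultimately show "tensor_norm d k (\<lambda>is. nabla d k ?f x is - nabla d k ?f y is)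
      \<le> B * fact k * ?c * edist d x y"
    unfolding tensor_norm_def by (intro cSUP_least) auto
qed

section \<open>The minimiser and quadratic growth around it\<close>

text \<open>Abel summation. With \<open>S\<close> the tail sums of the coordinates of the minimiser,
  the right-hand side vanishes and the first-order terms cancel.\<close>

lemma chain_summation_by_parts:
  fixes S h :: "nat \<Rightarrow> real"
  shows "(\<Sum>j<n. S (Suc j) * (h j - h (Suc j))) - S 0 * h 0 + (\<Sum>j<Suc n. (S j - S (Suc j)) * h j)
    = - S (Suc n) * h n"
  by (induction n) (auto simp: algebra_simps)

text \<open>\<open>S j\<close> is the sum of the coordinates from \<open>j\<close> on. Adding the
  optimality conditions of these coordinates gives the hypothesis on \<open>B\<close>, and adding
  all of them gives the slope \<open>lam * S 0\<close>. The quadratic term expands exactly around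
  \<open>xs\<close>, the convex links lie above their tangents there, and the first-order parts
  cancel.\<close>

lemma hard_function_growth:
  assumes on: "orthonormal d n v" and k: "k \<ge> 1" and B: "B \<ge> 0"
    and Sn: "S n = 0"
    and w: "\<And>j. w j = S j - S (Suc j)"
    and S: "\<And>j. Suc j < n \<Longrightarrow> B * max 0 (w j - w (Suc j)) ^ k = lam * S (Suc j)"
    and xs: "xs = (\<lambda>l. p l + (\<Sum>j<n. w j * v j l))"
  shows "hard_function d k lam B (lam * S 0) p v n x - hard_function d k lam B (lam * S 0) p v n xs
    \<ge> lam / 2 * ip d (\<lambda>l. x l - xs l) (\<lambda>l. x l - xs l)"
proof -
  define z where "z = (\<lambda>l. x l - xs l)"
  define h where "h j = ip d (v j) z" for j
  let ?G = "profile k lam B (lam * S 0)"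
  define t where "t j = ?G j 0 (ip d (dir v j) (\<lambda>i. x i - p i)) - ?G j 0 (ip d (dir v j) (\<lambda>i. xs i - p i))" for j
  have split: "hard_function d k lam B (lam * S 0) p v n x - hard_function d k lam B (lam * S 0) p v n xs
     = (\<Sum>i<d. t (Inl i)) + (\<Sum>q<n. t (Inr q))"
    by (simp add: hard_function_def ridge_sum_def sum.Plus t_def sum_subtractf)
  have y: "(\<lambda>i. xs i - p i) = (\<lambda>l. \<Sum>j<n. w j * v j l)" by (simp add: xs)
  have Inl: "(\<Sum>i<d. t (Inl i)) = lam * (\<Sum>j<n. w j * h j) + lam / 2 * ip d z z"
  proof -
    have "ip d (\<lambda>l. if l = i then 1 else 0) b = b i" if "i < d" for i b
      using that by (simp add: ip_def if_distrib if_distribR cong: if_cong)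
    then have "(\<Sum>i<d. t (Inl i)) = (\<Sum>i<d. lam * (z i * (xs i - p i)) + lam / 2 * (z i * z i))"
      by (intro sum.cong refl) (simp add: t_def z_def field_simps power2_eq_square)
    also have "\<dots> = lam * ip d z (\<lambda>i. xs i - p i) + lam / 2 * ip d z z"
      by (simp add: sum.distrib sum_distrib_left ip_def)
    also have "ip d z (\<lambda>i. xs i - p i) = (\<Sum>j<n. w j * h j)"
      unfolding y ip_sum_right h_def by (simp add: ip_commute)
    finally show ?thesis .
  qed
  have Inr: "(\<Sum>q<n. t (Inr q)) \<ge> - lam * (\<Sum>j<n. w j * h j)"
  proof (cases n)
    case 0
    then show ?thesis by simp
  next
    case (Suc n')
    have "t (Inr (Suc j)) \<ge> lam * (S (Suc j) * (h j - h (Suc j)))" if "j < n'" for j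
    proof -
      define X Y where "X = ip d (dir v (Inr (Suc j))) (\<lambda>i. x i - p i)"
        and "Y = ip d (dir v (Inr (Suc j))) (\<lambda>i. xs i - p i)"
      have XY: "X - Y = h j - h (Suc j)"
        by (simp add: X_def Y_def h_def z_def ip_diff_right ip_diff_left)
      have Y: "Y = w j - w (Suc j)"
      proof -
        have "j < n" "Suc j < n" using that Suc by auto
        then show ?thesis
          unfolding Y_def y by (simp add: ip_diff_left ip_orthonormal_combination[OF on])
      qed
      have "t (Inr (Suc j)) = B * (fact k / fact (Suc k)) * (max 0 X ^ Suc k - max 0 Y ^ Suc k)"
        by (simp add: t_def X_def Y_def right_diff_distrib)
      also have "\<dots> \<ge> B * (fact k / fact (Suc k)) * (real (Suc k) * max 0 Y ^ k * (X - Y))"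
        using B k by (intro mult_left_mono max0_power_Suc_ge_tangent) auto
      also have "B * (fact k / fact (Suc k)) * (real (Suc k) * max 0 Y ^ k * (X - Y))
         = B * max 0 Y ^ k * (X - Y)"
        by (simp add: fact_Suc[of k] del: fact_Suc)
      also have "\<dots> = lam * (S (Suc j) * (h j - h (Suc j)))"
        using S[of j] that Suc XY Y by simp
      finally show ?thesis .
    qed
    then have "(\<Sum>j<n'. t (Inr (Suc j))) \<ge> lam * (\<Sum>j<n'. S (Suc j) * (h j - h (Suc j)))"
      unfolding sum_distrib_left by (intro sum_mono) auto
    moreover have "t (Inr 0) = - (lam * (S 0 * h 0))"
      by (simp add: t_def h_def z_def ip_diff_right algebra_simps)
    moreover have "(\<Sum>q<n. t (Inr q)) = t (Inr 0) + (\<Sum>j<n'. t (Inr (Suc j)))"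
      unfolding Suc sum.lessThan_Suc_shift by simp
    moreover have "(\<Sum>j<n'. S (Suc j) * (h j - h (Suc j))) = S 0 * h 0 - (\<Sum>j<n. w j * h j)"
      using chain_summation_by_parts[of S h n'] Sn by (simp add: Suc w)
    ultimately show ?thesis by (simp add: right_diff_distrib)
  qed
  from Inl Inr split show ?thesis by (simp add: z_def)
qed


section \<open>The resisting oracle\<close>

text \<open>A further vector adds one link, from \<open>v' (m - 1)\<close> to \<open>v' m\<close>.
  At \<open>x\<close> its argument is 0, where the profile vanishes with all derivatives up to order
  \<open>k\<close>. The case \<open>m = 0\<close> is excluded because it would add the linear term,
  which is visible everywhere.\<close>

lemma hard_function_response_extend:
  assumes v: "\<And>i. i < m \<Longrightarrow> v' i = v i"
    and last: "ip d (v' m) (\<lambda>i. x i - p i) = 0"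
    and prev: "\<And>i. Suc i = m \<Longrightarrow> ip d (v' i) (\<lambda>i. x i - p i) = 0"
    and m: "m > 0"
  shows "query_response d k (hard_function d k lam B g p v' (Suc m)) x
    = query_response d k (hard_function d k lam B g p v m) x"
proof -
  obtain m0 where m0: "m = Suc m0" using m by (cases m) auto
  have dir: "dir v' (Inr q) = dir v (Inr q)" if "q < m" for q
    using that v by (cases q) auto
  have Inl: "dir v' (Inl q) = dir v (Inl q)" for q by simp
  have "ridge_sum d ({..<d} <+> {..<Suc m}) (dir v') p (profile k lam B g) is x
      = ridge_sum d ({..<d} <+> {..<m}) (dir v) p (profile k lam B g) is x" if "length is \<le> k" for "is"
  proof -
    have "ip d (dir v' (Inr m)) (\<lambda>i. x i - p i) = 0"
      using last prev[of m0] by (simp add: m0 ip_diff_left)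
    then have "profile k lam B g (Inr m) (length is) (ip d (dir v' (Inr m)) (\<lambda>i. x i - p i)) = 0"
      using that by (simp add: m0)
    then show ?thesis
      by (simp add: ridge_sum_def sum.Plus dir Inl del: dir.simps profile.simps)
  qed
  then show ?thesis
    unfolding query_response_def
    by (intro map_cong refl ext) (auto simp: nabla_hard_function tensor_indices_def)
qed

text \<open>
  The \<open>s\<close>-th query only sees \<open>v\<^sub>0, \<dots>, v\<^sub>s\<^sub>-\<^sub>1\<close>: all later vectors are chosen
  orthogonal to it, after it has been made.
\<close>

lemma resisting_orthonormal_system:
  assumes "2 * n \<le> d" "m \<le> n"
  shows "\<exists>v. (\<forall>i<m. v i \<in> Rd d) \<and> orthonormal d m v \<and>
    (\<forall>i<m. \<forall>s\<le>i. ip d (v i)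
       (\<lambda>l. alg (responses d k alg (hard_function d k lam B g (alg []) v m) s) l - alg [] l) = 0)"
  using assms(2)
proof (induction m)
  case 0
  then show ?case by (simp add: orthonormal_def)
next
  case (Suc m)
  let ?R = "\<lambda>v m. responses d k alg (hard_function d k lam B g (alg []) v m)"
  from Suc obtain v where v: "\<forall>i<m. v i \<in> Rd d" "orthonormal d m v"
    "\<And>i s. i < m \<Longrightarrow> s \<le> i \<Longrightarrow> ip d (v i) (\<lambda>l. alg (?R v m s) l - alg [] l) = 0" by auto
  \<comment> \<open>The constraints on the new vector: \<open>m\<close> earlier vectors and queries
    1 to \<open>m\<close>. Query 0 is the base point and imposes none. This makes
    \<open>2 * m\<close> constraints, fewer than \<open>d\<close> since
    \<open>Suc m \<le> n\<close>.\<close>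
  define a where "a = case_sum v (\<lambda>s l. alg (?R v m (Suc s)) l - alg [] l)"
  have "card ({..<m} <+> {..<m}) < d" using Suc.prems assms(1) by (simp add: card_Plus)
  then obtain u where u: "u \<in> Rd d" "ip d u u = 1" "\<forall>j\<in>{..<m} <+> {..<m}. ip d u (a j) = 0"
    using exists_unit_vector_orthogonal[of "{..<m} <+> {..<m}" d a] by auto
  have uv: "ip d u (v i) = 0" if "i < m" for i
    using bspec[OF u(3), OF InlI, of i] that by (simp add: a_def)
  have ux: "ip d u (\<lambda>l. alg (?R v m s) l - alg [] l) = 0" if "s \<le> m" for s
  proof (cases s)
    case 0
    then show ?thesis by (simp add: ip_def)
  next
    case (Suc s')
    then have "Inr s' \<in> {..<m} <+> {..<m}" using that by auto
    from bspec[OF u(3) this] show ?thesis by (simp add: a_def Suc del: responses.simps)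
  qed
  define v' where "v' = v(m := u)"
  \<comment> \<open>Adding \<open>u\<close> does not change the past: the first \<open>m\<close>
    responses stay the same, hence so do queries 0 to \<open>m\<close>.\<close>
  have R: "?R v' (Suc m) s = ?R v m s" if "s \<le> m" for s
    using that
  proof (induction s)
    case (Suc s)
    let ?x = "alg (?R v m s)"
    have "query_response d k (hard_function d k lam B g (alg []) v' (Suc m)) ?x
        = query_response d k (hard_function d k lam B g (alg []) v m) ?x"
      \<comment> \<open>This query has number \<open>s < m\<close>, so it is orthogonal to
        \<open>u\<close> by \<open>ux\<close> and to \<open>v (m - 1)\<close> by the induction
        hypothesis.\<close>
      by (rule hard_function_response_extend) (use Suc.prems ux v(3) in \<open>auto simp: v'_def\<close>)
    with Suc show ?case by simp
  qed simp
  have "orthonormal d (Suc m) v'"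
    using v(2) u(2) uv uv[unfolded ip_commute[of d u]] by (auto simp: orthonormal_def v'_def less_Suc_eq)
  moreover have "\<forall>i<Suc m. v' i \<in> Rd d" using v(1) u(1) by (auto simp: v'_def less_Suc_eq)
  moreover have "ip d (v' i) (\<lambda>l. alg (?R v' (Suc m) s) l - alg [] l) = 0" if "i < Suc m" "s \<le> i" for i s
  proof (cases "i = m")
    case True
    then show ?thesis using that R[of s] ux[of s] by (simp add: v'_def)
  next
    case False
    then show ?thesis using that R[of s] v(3)[of i s] by (simp add: v'_def)
  qed
  ultimately show ?case by blast
qed

section \<open>Coordinates of the minimiser and its distance from the base point\<close>

text \<open>
  \<open>tail_sum A k r\<close> is the sum of the last \<open>r\<close> coordinates of the minimiser, the last of
  which is \<open>1/4\<close>.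
\<close>

fun tail_sum :: "real \<Rightarrow> nat \<Rightarrow> nat \<Rightarrow> real" where
  "tail_sum A k 0 = 0"
| "tail_sum A k (Suc 0) = 1 / 4"
| "tail_sum A k (Suc (Suc r)) =
     tail_sum A k (Suc r) + (tail_sum A k (Suc r) - tail_sum A k r) + root k (tail_sum A k (Suc r) / A)"

text \<open>Coordinates are numbered from the end, \<open>r = 0\<close> being the last, because the
  optimality conditions are solved backwards.\<close>

definition tail_coord :: "real \<Rightarrow> nat \<Rightarrow> nat \<Rightarrow> real" where
  "tail_coord A k r = tail_sum A k (Suc r) - tail_sum A k r"

lemma tail_coord_0: "tail_coord A k 0 = 1 / 4"
  by (simp add: tail_coord_def)

lemma tail_coord_Suc: "tail_coord A k (Suc r) = tail_coord A k r + root k (tail_sum A k (Suc r) / A)"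
  by (simp add: tail_coord_def)

lemma tail_sum_Suc: "tail_sum A k (Suc r) = tail_sum A k r + tail_coord A k r"
  by (simp add: tail_coord_def)

lemma tail_coord_ge:
  assumes "A > 0" "k > 0"
  shows "tail_coord A k r \<ge> 1 / 4 \<and> tail_sum A k r \<ge> 0"
proof (induction r)
  case 0
  then show ?case by (simp add: tail_coord_0)
next
  case (Suc r)
  then have "tail_sum A k (Suc r) \<ge> 0" unfolding tail_sum_Suc by linarith
  moreover from this have "root k (tail_sum A k (Suc r) / A) \<ge> 0" using assms by simp
  ultimately show ?case unfolding tail_coord_Suc using Suc by linarith
qed

lemma tail_coord_mono:
  assumes "A > 0" "k > 0" "r \<le> s"
  shows "tail_coord A k r \<le> tail_coord A k s"
proof (rule lift_Suc_mono_le[of "tail_coord A k", OF _ assms(3)])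
  fix n
  have "root k (tail_sum A k (Suc n) / A) \<ge> 0" using assms tail_coord_ge[OF assms(1,2)] by simp
  then show "tail_coord A k n \<le> tail_coord A k (Suc n)" by (simp add: tail_coord_Suc)
qed

lemma tail_sum_le:
  assumes "A > 0" "k > 0" "r \<le> Suc s"
  shows "tail_sum A k r \<le> real r * tail_coord A k s"
  using assms(3)
proof (induction r)
  case (Suc r)
  then show ?case
    using tail_coord_mono[OF assms(1,2), of r s] by (simp add: tail_sum_Suc algebra_simps del: tail_sum.simps)
qed simp

text \<open>Each of the \<open>r\<close> increments is bounded by one root, since every tail sum
  involved is at most \<open>real (Suc s) * tail_coord A k s\<close>. For \<open>r = s\<close> this
  bounds the largest coordinate in terms of itself.\<close>

lemma tail_coord_le:
  assumes "A > 0" "k > 0" "r \<le> s"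
  shows "tail_coord A k r \<le> 1 / 4 + real r * root k (real (Suc s) * tail_coord A k s / A)"
  using assms(3)
proof (induction r)
  case 0
  then show ?case by (simp add: tail_coord_0)
next
  case (Suc r)
  define c where "c = root k (real (Suc s) * tail_coord A k s / A)"
  have M: "tail_coord A k s \<ge> 0" using tail_coord_ge[OF assms(1,2), of s] by linarith
  have "tail_sum A k (Suc r) \<le> real (Suc r) * tail_coord A k s"
    by (rule tail_sum_le[OF assms(1,2)]) (use Suc in simp)
  also have "\<dots> \<le> real (Suc s) * tail_coord A k s"
    using Suc.prems M by (intro mult_right_mono) auto
  finally have "root k (tail_sum A k (Suc r) / A) \<le> root k (real (Suc s) * tail_coord A k s / A)"
    using assms by (simp add: divide_right_mono)
  then have "root k (tail_sum A k (Suc r) / A) \<le> c" by (simp only: c_def)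
  moreover have "tail_coord A k r \<le> 1 / 4 + real r * c" unfolding c_def using Suc by simp
  moreover have "real (Suc r) * c = real r * c + c" by (simp add: algebra_simps)
  ultimately show ?case unfolding tail_coord_Suc c_def[symmetric] by linarith
qed

text \<open>If the largest coordinate \<open>M\<close> is at most 1/2, it suffices that
  \<open>real d \<le> D\<^sup>2\<close>. Otherwise the self-bound of \<open>tail_coord_le\<close>
  limits M^(k-1), and the hypothesis on \<open>d\<close> is what turns this limit into the
  claim.\<close>

lemma square_tail_coord_le:
  assumes A: "A > 0" and k: "k \<ge> 2" and D: "D > 0" "A \<le> D\<^sup>2"
    and d: "2 * Suc s \<le> d" "real d ^ (3 * k + 1) \<le> (A * D ^ (k - 1))\<^sup>2"
  shows "real (Suc s) * (tail_coord A k s)\<^sup>2 \<le> D\<^sup>2"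
proof -
  define n M where "n = real (Suc s)" and "M = tail_coord A k s"
  have n: "n \<ge> 1" "2 * n \<le> real d" using d(1) by (auto simp: n_def)
  have M: "M \<ge> 1 / 4" using tail_coord_ge[OF A, of k s] k by (simp add: M_def)
  show ?thesis
  proof (cases "M \<le> 1 / 2")
    case True
    have "real d \<le> D\<^sup>2"
    proof (rule ccontr)
      assume "\<not> real d \<le> D\<^sup>2"
      \<comment> \<open>Inserting \<open>A \<le> D\<^sup>2\<close> into the bound on
        \<open>d\<close> leaves the same power \<open>k + 1\<close> on both sides.\<close>
      then have "(D\<^sup>2) ^ (k + 1) < real d ^ (k + 1)" by (intro power_strict_mono) auto
      also have "\<dots> \<le> real d ^ (3 * k + 1)" using n by (intro power_increasing) auto
      also have "\<dots> \<le> A\<^sup>2 * (D ^ (k - 1))\<^sup>2" using d(2) by (simp add: power_mult_distrib)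
      also have "\<dots> \<le> (D\<^sup>2)\<^sup>2 * (D ^ (k - 1))\<^sup>2"
        using D A by (intro mult_right_mono power_mono) auto
      also have "\<dots> = (D * D * D ^ (k - 1))\<^sup>2"
        by (simp add: power2_eq_square power_mult_distrib mult_ac)
      also have "D * D * D ^ (k - 1) = D ^ (k + 1)" using k by (cases k) auto
      also have "(D ^ (k + 1))\<^sup>2 = (D\<^sup>2) ^ (k + 1)" by (simp only: power_mult[symmetric] mult.commute)
      finally show False by simp
    qed
    moreover have "M\<^sup>2 \<le> (1 / 2)\<^sup>2" using True M by (intro power_mono) auto
    then have "n * M\<^sup>2 \<le> n * 1" using n by (intro mult_left_mono) (auto simp: power2_eq_square)
    ultimately show ?thesis using n unfolding n_def M_def by linarith
  next
    case False
    have "M \<le> 1 / 4 + real s * root k (n * M / A)"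
      using tail_coord_le[OF A, of k s s] k by (simp add: M_def n_def)
    also have "\<dots> \<le> 1 / 4 + n * root k (n * M / A)"
      using n M A k by (intro add_left_mono mult_right_mono) (auto simp: n_def)
    \<comment> \<open>As \<open>M > 1/2\<close>, the summand 1/4 is less than half of
      \<open>M\<close> and is absorbed by the factor 2.\<close>
    finally have "M \<le> 2 * n * root k (n * M / A)" using False by simp
    then have "M ^ k \<le> (2 * n * root k (n * M / A)) ^ k" using M by (intro power_mono) auto
    also have "\<dots> = (2 * n) ^ k * (n * M / A)"
      using k n M A by (simp add: power_mult_distrib real_root_pow_pos2)
    finally have "M ^ (k - 1) * M \<le> (2 * n) ^ k * n / A * M"
      using k by (cases k) (auto simp: mult_ac)
    then have Mk: "M ^ (k - 1) \<le> (2 * n) ^ k * n / A"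
      by (rule mult_right_le_imp_le) (use M in simp)
    show ?thesis
    proof (rule ccontr)
      assume "\<not> ?thesis"
      \<comment> \<open>The power \<open>k - 1\<close> is the one for which \<open>Mk\<close>
        applies; collecting the powers of \<open>n\<close> then produces the exponent
        \<open>3 * k + 1\<close>.\<close>
      then have "(D\<^sup>2) ^ (k - 1) < (n * M\<^sup>2) ^ (k - 1)"
        using k by (intro power_strict_mono) (auto simp: n_def M_def)
      also have "\<dots> = n ^ (k - 1) * (M ^ (k - 1))\<^sup>2"
        by (simp add: power_mult_distrib power_mult[symmetric] mult.commute)
      also have "\<dots> \<le> n ^ (k - 1) * ((2 * n) ^ k * n / A)\<^sup>2"
        using Mk M n by (intro mult_left_mono power_mono) auto
      also have "\<dots> = 2 ^ (2 * k) * n ^ (3 * k + 1) / A\<^sup>2"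
      proof -
        have "n ^ (k - 1) * (n ^ k * n)\<^sup>2 = n ^ (3 * k + 1)"
        proof -
          have "n ^ (k - 1) * (n ^ k * n)\<^sup>2 = n ^ ((k - 1) + (k + 1) * 2)"
            by (simp only: power_add power_mult power_one_right)
          also have "(k - 1) + (k + 1) * 2 = 3 * k + 1" using k by simp
          finally show ?thesis .
        qed
        moreover have "n ^ (k - 1) * ((2 * n) ^ k * n / A)\<^sup>2
            = (2 ^ k)\<^sup>2 * (n ^ (k - 1) * (n ^ k * n)\<^sup>2) / A\<^sup>2"
          by (simp add: power_mult_distrib power_divide)
        moreover have "(2 ^ k)\<^sup>2 = (2 :: real) ^ (2 * k)" by (simp add: power_mult[symmetric] mult.commute)
        ultimately show ?thesis by simp
      qed
      \<comment> \<open>The power of 2 is enlarged to match that of \<open>n\<close>, because the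
        bound at hand is \<open>2 * n \<le> real d\<close>.\<close>
      also have "\<dots> \<le> 2 ^ (3 * k + 1) * n ^ (3 * k + 1) / A\<^sup>2"
        using n by (intro divide_right_mono mult_right_mono power_increasing) auto
      also have "\<dots> = (2 * n) ^ (3 * k + 1) / A\<^sup>2" by (simp only: power_mult_distrib)
      also have "\<dots> \<le> real d ^ (3 * k + 1) / A\<^sup>2"
        using n by (intro divide_right_mono power_mono) auto
      also have "\<dots> \<le> (A * D ^ (k - 1))\<^sup>2 / A\<^sup>2" by (intro divide_right_mono d(2)) auto
      also have "\<dots> = (D\<^sup>2) ^ (k - 1)"
        using A by (simp add: power_mult_distrib power_mult[symmetric] mult.commute)
      finally show False by simp
    qed
  qed
qed

text \<open>The optimality condition that the recursion was made to satisfy, with \<open>A\<close>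
  the ratio of \<open>B\<close> and \<open>lam\<close>.\<close>

lemma tail_sum_gap:
  assumes "A > 0" "k > 0"
  shows "max 0 (tail_coord A k (Suc r) - tail_coord A k r) ^ k = tail_sum A k (Suc r) / A"
proof -
  have "tail_sum A k (Suc r) / A \<ge> 0" using tail_coord_ge[OF assms] assms(1) by simp
  then show ?thesis using assms(2) by (simp add: tail_coord_Suc max_def real_root_pow_pos2 del: tail_sum.simps)
qed

text \<open>A point that misses \<open>v t\<close> is off by the full coordinate \<open>w t\<close>
  in that direction, and Bessel's inequality carries this over to the whole distance.\<close>

lemma optimality_gap_of_orthogonal:
  assumes on: "orthonormal d n v" and t: "t < n" and w: "w t \<ge> 1 / 4"
    and y: "ip d (v t) (\<lambda>l. x l - p l) = 0"
  shows "ip d (\<lambda>l. x l - (p l + (\<Sum>j<n. w j * v j l))) (\<lambda>l. x l - (p l + (\<Sum>j<n. w j * v j l))) \<ge> 1 / 16"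
proof -
  let ?z = "\<lambda>l. x l - (p l + (\<Sum>j<n. w j * v j l))"
  have "ip d (v t) ?z = ip d (v t) (\<lambda>l. (x l - p l) - (\<Sum>j<n. w j * v j l))"
    by (simp add: algebra_simps)
  also have "\<dots> = - w t"
    unfolding ip_diff_right[of d "v t" "\<lambda>l. x l - p l"] using y ip_orthonormal_combination[OF on t] by simp
  finally have "(w t)\<^sup>2 = (ip d (v t) ?z)\<^sup>2" by simp
  also have "\<dots> \<le> (\<Sum>j<n. (ip d (v j) ?z)\<^sup>2)"
    using t by (intro member_le_sum) auto
  also have "\<dots> \<le> ip d ?z ?z" by (rule bessel_inequality[OF on])
  finally have "(w t)\<^sup>2 \<le> ip d ?z ?z" .
  moreover have "(1 / 4)\<^sup>2 \<le> (w t)\<^sup>2" using w by (intro power_mono) auto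
  ultimately show ?thesis by (simp add: power2_eq_square)
qed

section \<open>Assembling the lower bound\<close>

lemma resisting_function:
  fixes lam B D \<epsilon> :: real
  assumes k: "k \<ge> 2" and lam: "lam > 0" and B: "B > 0" and D: "D > 0" "B / lam \<le> D\<^sup>2"
    and d: "d \<ge> 1" "real d ^ (3 * k + 1) \<le> (B / lam * D ^ (k - 1))\<^sup>2"
    and eps: "\<epsilon> < lam / 32" and alg: "deterministic_algorithm d alg"
  shows "\<exists>f. strongly_convex d lam f \<and> times_differentiable d k f \<and>
    lipschitz_kth_derivative d k (B * fact k * 2 powr ((real k + 3) / 2)) f \<and>
    (\<exists>xs. global_minimum d f xs \<and> edist d (iterate d k alg f 1) xs \<le> D \<and>
      (\<forall>T\<ge>1. f (iterate d k alg f T) - f xs \<le> \<epsilon> \<longrightarrow> real T \<ge> 1 / 2 * real d))"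
proof -
  define A where "A = B / lam"
  define n where "n = d div 2"
  define p where "p = alg []"
  define S where "S j = tail_sum A k (n - j)" for j
  define w where "w j = S j - S (Suc j)" for j
  have A: "A > 0" using lam B by (simp add: A_def)
  have k0: "k > 0" using k by simp
  have w_eq: "w j = tail_coord A k (n - Suc j)" if "j < n" for j
    using that by (simp add: w_def S_def tail_coord_def Suc_diff_Suc del: tail_sum.simps)
  have w_ge: "w j \<ge> 1 / 4" if "j < n" for j
    using tail_coord_ge[OF A k0] w_eq[OF that] by simp
  have Sw: "B * max 0 (w j - w (Suc j)) ^ k = lam * S (Suc j)" if "Suc j < n" for j
  proof -
    define r where "r = n - Suc (Suc j)"
    have r: "n - Suc j = Suc r" using that by (simp add: r_def)
    have "max 0 (w j - w (Suc j)) ^ k = S (Suc j) / A"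
      using that tail_sum_gap[OF A k0, of r] by (simp add: w_eq S_def r r_def[symmetric] del: tail_sum.simps)
    then show ?thesis using lam B by (simp add: A_def)
  qed
  \<comment> \<open>The slope \<open>lam * S 0\<close> depends only on \<open>A\<close>,
    \<open>k\<close> and \<open>n\<close>, so it is fixed before the adversary chooses any
    vector.\<close>
  obtain v where v: "\<forall>i<n. v i \<in> Rd d" "orthonormal d n v"
    "\<forall>i<n. \<forall>s\<le>i. ip d (v i)
       (\<lambda>l. alg (responses d k alg (hard_function d k lam B (lam * S 0) p v n) s) l - p l) = 0"
    using resisting_orthonormal_system[of n d n alg k lam B "lam * S 0"] by (auto simp: n_def p_def)
  define f where "f = hard_function d k lam B (lam * S 0) p v n"
  define xs where "xs = (\<lambda>l. p l + (\<Sum>j<n. w j * v j l))"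
  have p: "p \<in> Rd d" using alg by (simp add: p_def deterministic_algorithm_def)
  have xs: "xs \<in> Rd d" using p v(1) by (auto simp: mem_Rd_iff xs_def)
  have growth: "f x - f xs \<ge> lam / 2 * ip d (\<lambda>l. x l - xs l) (\<lambda>l. x l - xs l)" for x
    unfolding f_def
    by (rule hard_function_growth[OF v(2) _ _ _ w_def Sw xs_def]) (use k B in \<open>auto simp: S_def\<close>)
  have "global_minimum d f xs"
    unfolding global_minimum_def
  proof (intro conjI xs ballI)
    fix y
    have "lam / 2 * ip d (\<lambda>l. y l - xs l) (\<lambda>l. y l - xs l) \<ge> 0" using lam by (simp add: ip_self_nonneg)
    then show "f xs \<le> f y" using growth[of y] by linarith
  qed
  moreover have "edist d (iterate d k alg f 1) xs \<le> D"
  proof -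
    have "(edist d (iterate d k alg f 1) xs)\<^sup>2 = ip d (\<lambda>l. p l - xs l) (\<lambda>l. p l - xs l)"
      by (simp add: edist_def enorm_eq_sqrt_ip ip_self_nonneg iterate_def p_def)
    also have "\<dots> = ip d (\<lambda>l. \<Sum>j<n. w j * v j l) (\<lambda>l. \<Sum>j<n. w j * v j l)"
      by (simp add: ip_def xs_def)
    also have "\<dots> = (\<Sum>j<n. (w j)\<^sup>2)" by (rule ip_self_orthonormal_combination[OF v(2)])
    also have "\<dots> \<le> D\<^sup>2"
    proof (cases n)
      case 0
      then show ?thesis by simp
    next
      case (Suc s)
      \<comment> \<open>Here \<open>s\<close> is \<open>n - 1\<close>, so
        \<open>tail_coord A k s\<close> is \<open>w 0\<close>, the largest coordinate.\<close>
      have "(\<Sum>j<n. (w j)\<^sup>2) \<le> (\<Sum>j<n. (tail_coord A k s)\<^sup>2)"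
      proof (intro sum_mono power_mono)
        fix j assume j: "j \<in> {..<n}"
        then show "w j \<le> tail_coord A k s" using Suc w_eq[of j] tail_coord_mono[OF A k0, of "n - Suc j" s] by simp
        show "0 \<le> w j" using w_ge[of j] j by simp
      qed
      also have "\<dots> = real (Suc s) * (tail_coord A k s)\<^sup>2" using Suc by simp
      also have "\<dots> \<le> D\<^sup>2"
        by (rule square_tail_coord_le[OF A k _ _ _ d(2)[folded A_def]]) (use D Suc in \<open>auto simp: A_def n_def\<close>)
      finally show ?thesis .
    qed
    finally show ?thesis by (rule power2_le_imp_le) (use D(1) in simp)
  qed
  moreover have "real T \<ge> 1 / 2 * real d" if "T \<ge> 1" "f (iterate d k alg f T) - f xs \<le> \<epsilon>" for T
  proof (cases "T \<le> n")
    case True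
    let ?x = "iterate d k alg f T"
    \<comment> \<open>The iterate numbered \<open>T\<close> from 1 is query \<open>T - 1\<close>
      numbered from 0, so it misses \<open>v (T - 1)\<close>. The resulting gap of at least
      \<open>lam / 32\<close> exceeds \<open>\<epsilon>\<close>.\<close>
    have "ip d (v (T - 1)) (\<lambda>l. ?x l - p l) = 0"
      using v(3) True that(1) by (simp add: iterate_def f_def)
    then have "ip d (\<lambda>l. ?x l - xs l) (\<lambda>l. ?x l - xs l) \<ge> 1 / 16"
      unfolding xs_def by (intro optimality_gap_of_orthogonal[OF v(2), of "T - 1"] w_ge) (use True that in auto)
    then have "lam / 2 * ip d (\<lambda>l. ?x l - xs l) (\<lambda>l. ?x l - xs l) \<ge> lam / 2 * (1 / 16)"
      using lam by (intro mult_left_mono) auto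
    then show ?thesis using growth[of ?x] that(2) eps by linarith
  next
    case False
    \<comment> \<open>Since \<open>n\<close> is \<open>d\<close> halved and rounded down,
      \<open>T > n\<close> suffices even for odd \<open>d\<close>; this gives the constant
      1/2.\<close>
    then have "d \<le> 2 * T" by (simp add: n_def)
    then have "real d \<le> 2 * real T" by linarith
    then show ?thesis by simp
  qed
  moreover have "strongly_convex d lam f" "times_differentiable d k f"
    "lipschitz_kth_derivative d k (B * fact k * 2 powr ((real k + 3) / 2)) f"
    unfolding f_def using k d(1) B v(2)
    by (auto intro!: strongly_convex_hard_function times_differentiable_hard_function lipschitz_hard_function)
  ultimately show ?thesis by blast
qed

lemma power_le_square_of_le_powr:
  fixes X :: real
  assumes "real d \<le> X powr (2 / (3 * real k + 1))" "X > 0"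
  shows "real d ^ (3 * k + 1) \<le> X\<^sup>2"
proof -
  have "real d ^ (3 * k + 1) \<le> (X powr (2 / (3 * real k + 1))) ^ (3 * k + 1)"
    using assms(1) by (intro power_mono) auto
  also have "\<dots> = X powr (real (3 * k + 1) * (2 / (3 * real k + 1)))"
    by (rule powr_power) (use assms(2) in simp)
  also have "real (3 * k + 1) * (2 / (3 * real k + 1)) = 2"
    by (simp add: field_simps add_nonneg_eq_0_iff)
  also have "X powr 2 = X\<^sup>2" using assms(2) by simp
  finally show ?thesis .
qed

theorem theorem3:
  shows "\<exists>c::real. c > 0 \<and>
    (\<forall>(k::nat) (lam::real) (\<mu>::real) (D::real) (\<epsilon>::real) (d::nat).
       k \<ge> 2 \<longrightarrow> lam > 0 \<longrightarrow> \<mu> > 0 \<longrightarrow> D > 0 \<longrightarrow> \<epsilon> > 0 \<longrightarrow> d \<ge> 1 \<longrightarrow>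
       D > sqrt (\<mu> / (fact k * 2 powr ((real k + 3) / 2) * lam)
                 + sqrt 2 * (\<mu> / (fact k * 2 powr ((real k + 3) / 2) * lam)) powr (3 / 2)) \<longrightarrow>
       \<epsilon> < lam / 32 \<longrightarrow>
       real d \<le> (\<mu> * D ^ (k - 1) / (fact k * 2 powr ((real k + 3) / 2) * lam))
                    powr (2 / (3 * real k + 1)) \<longrightarrow>
       (\<forall>alg. deterministic_algorithm d alg \<longrightarrow>
          (\<exists>f. strongly_convex d lam f \<and>
               times_differentiable d k f \<and>
               lipschitz_kth_derivative d k \<mu> f \<and>
               (\<exists>xs. global_minimum d f xs \<and>
                     edist d (iterate d k alg f 1) xs \<le> D \<and>
                     (\<forall>T\<ge>1. f (iterate d k alg f T) - f xs \<le> \<epsilon> \<longrightarrow> real T \<ge> c * real d)))))"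
proof (intro exI[of _ "1 / 2"] conjI allI impI)
  fix k :: nat and lam \<mu> D \<epsilon> :: real and d :: nat and alg
  define C where "C = fact k * 2 powr ((real k + 3) / 2)"
  assume k: "2 \<le> k" and lam: "0 < lam" and mu: "0 < \<mu>" and D: "0 < D" and d: "1 \<le> d"
    and D_gt: "sqrt (\<mu> / (fact k * 2 powr ((real k + 3) / 2) * lam)
      + sqrt 2 * (\<mu> / (fact k * 2 powr ((real k + 3) / 2) * lam)) powr (3 / 2)) < D"
    and eps: "\<epsilon> < lam / 32"
    and d_le: "real d \<le> (\<mu> * D ^ (k - 1) / (fact k * 2 powr ((real k + 3) / 2) * lam)) powr (2 / (3 * real k + 1))"
    and alg: "deterministic_algorithm d alg"
  note D_gt = D_gt[folded C_def] and d_le = d_le[folded C_def]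
  have C: "C > 0" by (simp add: C_def)
  \<comment> \<open>Chosen so that the Lipschitz constant of the hard function is exactly
    \<open>\<mu>\<close>.\<close>
  define B where "B = \<mu> / C"
  have B: "B > 0" using mu C by (simp add: B_def)
  have A: "B / lam = \<mu> / (C * lam)" by (simp add: B_def)
  have "B / lam \<le> D\<^sup>2"
  proof -
    have "sqrt (B / lam) \<le> sqrt (B / lam + sqrt 2 * (B / lam) powr (3 / 2))" by simp
    then have "sqrt (B / lam) \<le> D" using D_gt unfolding A by linarith
    then show ?thesis using D by (simp add: real_sqrt_le_iff' sqrt_le_D)
  qed
  moreover have "real d ^ (3 * k + 1) \<le> (B / lam * D ^ (k - 1))\<^sup>2"
  proof -
    have eq: "\<mu> * D ^ (k - 1) / (C * lam) = B / lam * D ^ (k - 1)" by (simp add: B_def)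
    have pos: "B / lam * D ^ (k - 1) > 0" using B lam D by simp
    show ?thesis using d_le pos unfolding eq by (rule power_le_square_of_le_powr)
  qed
  ultimately have "\<exists>f. strongly_convex d lam f \<and> times_differentiable d k f \<and>
    lipschitz_kth_derivative d k (B * fact k * 2 powr ((real k + 3) / 2)) f \<and>
    (\<exists>xs. global_minimum d f xs \<and> edist d (iterate d k alg f 1) xs \<le> D \<and>
      (\<forall>T\<ge>1. f (iterate d k alg f T) - f xs \<le> \<epsilon> \<longrightarrow> real T \<ge> 1 / 2 * real d))"
    using resisting_function[OF k lam B D _ d _ eps alg] by blast
  moreover have "B * fact k * 2 powr ((real k + 3) / 2) = \<mu>"
    using C by (simp add: B_def C_def)
  ultimately show "\<exists>f. strongly_convex d lam f \<and> times_differentiable d k f \<and>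
    lipschitz_kth_derivative d k \<mu> f \<and>
    (\<exists>xs. global_minimum d f xs \<and> edist d (iterate d k alg f 1) xs \<le> D \<and>
      (\<forall>T\<ge>1. f (iterate d k alg f T) - f xs \<le> \<epsilon> \<longrightarrow> real T \<ge> 1 / 2 * real d))"
    by simp
qed simp

end
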